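(* Let $G$ be a finite non-solvable group. Then $\mathcal{NS}_G$ is not projective.
   Context: For a group $G$, $\mathrm{Sol}(G)=\{x\in G : \langle x,y\rangle \text{ is solvable for all } y\in G\}$. The non-solvable graph $\mathcal{NS}_G$ is the simple graph with vertex set $G\setminus \mathrm{Sol}(G)$ in which two distinct vertices $x,y$ are adjacent if and only if $\langle x,y\rangle$ is not solvable. Let $N_k$ denote the compact surface that is a connected sum of $k$ projective planes. A simple graph which can be embedded in $N_k$ but not in $N_{k-1}$ is called a graph of crosscap $k$ (with $N_0$ the sphere), and a graph of crosscap $1$ is called projective. *)

theory Defs
  imports "HOL-Analysis.Analysis" "HOL-Algebra.Solvable_Groups"
begin

section \<open>The non-solvable graph\<close>

abbreviation two_gen_subgroup :: "('a, 'b) monoid_scheme \<Rightarrow> 'a \<Rightarrow> 'a \<Rightarrow> ('a, 'b) monoid_scheme" where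
  "two_gen_subgroup G x y \<equiv> G\<lparr>carrier := generate G {x, y}\<rparr>"

definition Sol :: "('a, 'b) monoid_scheme \<Rightarrow> 'a set" where
  "Sol G = {x \<in> carrier G. \<forall>y \<in> carrier G. solvable (two_gen_subgroup G x y)}"

text \<open>A simple graph is a pair \<open>(V, E)\<close> where \<open>E\<close> consists of two-element subsets of \<open>V\<close>.\<close>

type_synonym 'v sgraph = "'v set \<times> 'v set set"

definition nonsolvable_graph :: "('a, 'b) monoid_scheme \<Rightarrow> 'a sgraph" where
  "nonsolvable_graph G =
     (carrier G - Sol G,
      {{x, y} | x y. x \<in> carrier G - Sol G \<and> y \<in> carrier G - Sol G \<and> x \<noteq> y
                     \<and> \<not> solvable (two_gen_subgroup G x y)})"


section \<open>Embeddings of graphs in topological spaces\<close>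

text \<open>
  Vertices go to distinct points and every edge to an arc joining the images of its two ends;
  the interior of an arc meets no vertex and no other arc.  For a finite graph and a Hausdorff
  space this is the same as a topological embedding of the geometric realization of the graph.
\<close>

definition graph_embedding ::
  "'v sgraph \<Rightarrow> 'x topology \<Rightarrow> ('v \<Rightarrow> 'x) \<Rightarrow> ('v set \<Rightarrow> real \<Rightarrow> 'x) \<Rightarrow> bool" where
  "graph_embedding \<Gamma> X p \<gamma> \<longleftrightarrow>
     p ` fst \<Gamma> \<subseteq> topspace X \<and> inj_on p (fst \<Gamma>) \<and>
     (\<forall>e \<in> snd \<Gamma>. embedding_map (top_of_set {0..1}) X (\<gamma> e) \<and>
        {\<gamma> e 0, \<gamma> e 1} = p ` e \<and> \<gamma> e ` {0<..<1} \<inter> p ` fst \<Gamma> = {}) \<and>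
     (\<forall>e \<in> snd \<Gamma>. \<forall>e' \<in> snd \<Gamma>. e \<noteq> e' \<longrightarrow> \<gamma> e ` {0<..<1} \<inter> \<gamma> e' ` {0<..<1} = {})"

definition embeds_in :: "'v sgraph \<Rightarrow> 'x topology \<Rightarrow> bool" where
  "embeds_in \<Gamma> X \<longleftrightarrow> (\<exists>p \<gamma>. graph_embedding \<Gamma> X p \<gamma>)"


section \<open>The surfaces \<open>N\<^sub>k\<close>\<close>

abbreviation sphere2 :: "(real^3) topology" where
  "sphere2 \<equiv> top_of_set (sphere 0 1)"

text \<open>The sphere with antipodal points identified, carrying the quotient topology.\<close>

definition projective_plane :: "(real^3) set topology" where
  "projective_plane = topology (\<lambda>U. U \<subseteq> (\<lambda>x. {x, -x}) ` sphere 0 1 \<and>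
     openin sphere2 {x \<in> sphere 0 1. {x, -x} \<in> U})"

text \<open>
  \<open>Z\<close> is a connected sum of \<open>X\<close> and \<open>Y\<close>: remove from each of \<open>X\<close> and \<open>Y\<close> the interior of an
  embedded closed disc (\<open>d\<close> and \<open>e\<close> below) and glue the remainders along the boundary circles.
  The gluing is expressed internally: \<open>Z\<close> is the union of closed copies of the two remainders
  (under \<open>f\<close> and \<open>g\<close>) that meet exactly in the image of both boundary circles.  As \<open>f\<close> and \<open>g\<close>
  are closed maps, \<open>Z\<close> then carries the quotient topology of the glued disjoint union.
\<close>

definition connected_sum :: "'x topology \<Rightarrow> 'y topology \<Rightarrow> 'z topology \<Rightarrow> bool" where
  "connected_sum X Y Z \<longleftrightarrow>
     (\<exists>(d :: complex \<Rightarrow> 'x) (e :: complex \<Rightarrow> 'y) f g.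
        let X' = topspace X - d ` ball 0 1; Y' = topspace Y - e ` ball 0 1 in
        embedding_map (top_of_set (cball 0 1)) X d \<and>
        embedding_map (top_of_set (cball 0 1)) Y e \<and>
        embedding_map (subtopology X X') Z f \<and> closed_map (subtopology X X') Z f \<and>
        embedding_map (subtopology Y Y') Z g \<and> closed_map (subtopology Y Y') Z g \<and>
        f ` X' \<union> g ` Y' = topspace Z \<and>
        f ` X' \<inter> g ` Y' = f ` d ` sphere 0 1 \<and>
        f ` X' \<inter> g ` Y' = g ` e ` sphere 0 1)"

text \<open>
  \<open>is_N k X\<close> says that \<open>X\<close> is (homeomorphic to) the connected sum of \<open>k\<close> projective planes,
  with the sphere for \<open>k = 0\<close>.  The point type is that of the projective plane; it has the
  cardinality of the continuum, so every \<open>N\<^sub>k\<close> has a copy on it.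
\<close>

fun is_N :: "nat \<Rightarrow> (real^3) set topology \<Rightarrow> bool" where
  "is_N 0 X \<longleftrightarrow> X homeomorphic_space sphere2"
| "is_N (Suc 0) X \<longleftrightarrow> X homeomorphic_space projective_plane"
| "is_N (Suc (Suc k)) X \<longleftrightarrow> (\<exists>Y. is_N (Suc k) Y \<and> connected_sum Y projective_plane X)"

definition embeds_in_N :: "'v sgraph \<Rightarrow> nat \<Rightarrow> bool" where
  "embeds_in_N \<Gamma> k \<longleftrightarrow> (\<exists>X. is_N k X \<and> embeds_in \<Gamma> X)"

definition has_crosscap :: "'v sgraph \<Rightarrow> nat \<Rightarrow> bool" where
  "has_crosscap \<Gamma> k \<longleftrightarrow> embeds_in_N \<Gamma> k \<and> (k > 0 \<longrightarrow> \<not> embeds_in_N \<Gamma> (k - 1))"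

definition projective :: "'v sgraph \<Rightarrow> bool" where
  "projective \<Gamma> \<longleftrightarrow> has_crosscap \<Gamma> 1"


subsection \<open>Basic facts\<close>

lemma openin_projective_plane:
  "openin projective_plane U \<longleftrightarrow> U \<subseteq> (\<lambda>x. {x, -x}) ` sphere 0 1 \<and>
     openin sphere2 {x \<in> sphere 0 1. {x, -x} \<in> U}"
proof -
  have "istopology (\<lambda>U. U \<subseteq> (\<lambda>x. {x, -x}) ` sphere 0 1 \<and>
     openin sphere2 {x \<in> sphere 0 1. {x, -x} \<in> U})" (is "istopology ?L")
    unfolding istopology_def
  proof (intro conjI allI impI)
    fix S T assume S: "?L S" and T: "?L T"
    have "{x \<in> sphere 0 1. {x, -x} \<in> S \<inter> T} =
      {x \<in> sphere 0 1. {x, -x} \<in> S} \<inter> {x \<in> sphere 0 1. {x, -x} \<in> T}" by auto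
    moreover have "openin sphere2 ({x \<in> sphere 0 1. {x, -x} \<in> S} \<inter> {x \<in> sphere 0 1. {x, -x} \<in> T})"
      using S T by (intro openin_Int) simp_all
    ultimately show "openin sphere2 {x \<in> sphere 0 1. {x, -x} \<in> S \<inter> T}"
      by (simp only:)
    show "S \<inter> T \<subseteq> (\<lambda>x. {x, -x}) ` sphere 0 1" using S by blast
  next
    fix K assume K: "\<forall>S\<in>K. ?L S"
    have "{x \<in> sphere 0 1. {x, -x} \<in> \<Union>K} = \<Union>((\<lambda>S. {x \<in> sphere 0 1. {x, -x} \<in> S}) ` K)" by auto
    moreover have "openin sphere2 (\<Union>((\<lambda>S. {x \<in> sphere 0 1. {x, -x} \<in> S}) ` K))"
      using K by (intro openin_Union) blast
    ultimately show "openin sphere2 {x \<in> sphere 0 1. {x, -x} \<in> \<Union>K}"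
      by (simp only:)
    show "\<Union>K \<subseteq> (\<lambda>x. {x, -x}) ` sphere 0 1" using K by blast
  qed
  then show ?thesis unfolding projective_plane_def by (simp add: topology_inverse')
qed

lemma topspace_projective_plane: "topspace projective_plane = (\<lambda>x. {x, -x}) ` sphere 0 1"
proof
  show "topspace projective_plane \<subseteq> (\<lambda>x. {x, -x}) ` sphere 0 1"
    using openin_topspace[of projective_plane] unfolding openin_projective_plane by blast
  have "{x \<in> sphere 0 1. {x, -x} \<in> (\<lambda>x. {x, -x}) ` sphere 0 1} = sphere (0::real^3) 1" by auto
  then have "openin projective_plane ((\<lambda>x. {x, -x}) ` sphere 0 1)"
    unfolding openin_projective_plane by simp
  then show "(\<lambda>x. {x, -x}) ` sphere 0 1 \<subseteq> topspace projective_plane"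
    by (rule openin_subset)
qed

lemma quotient_map_projective_plane:
  "quotient_map sphere2 projective_plane (\<lambda>x. {x, -x})"
  unfolding quotient_map_def
  by (auto simp: openin_projective_plane topspace_projective_plane)

lemma embedding_map_injective: "embedding_map X Y f \<Longrightarrow> inj_on f (topspace X)"
  unfolding embedding_map_def by (rule homeomorphic_imp_injective_map)

lemma embedding_map_image: "embedding_map X Y f \<Longrightarrow> f ` topspace X \<subseteq> topspace Y"
  using homeomorphic_imp_surjective_map[of X "subtopology Y (f ` topspace X)" f]
  unfolding embedding_map_def topspace_subtopology by blast

lemma embeds_in_compose_embedding:
  assumes "embeds_in \<Gamma> X" "embedding_map X Y h"
  shows "embeds_in \<Gamma> Y"
proof -
  from assms(1) obtain p \<gamma> where *: "graph_embedding \<Gamma> X p \<gamma>" unfolding embeds_in_def by blast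
  note inj = embedding_map_injective[OF assms(2)] and sub = embedding_map_image[OF assms(2)]
  have pX: "p ` fst \<Gamma> \<subseteq> topspace X" using * by (simp add: graph_embedding_def)
  have gX: "\<gamma> e ` {0..1} \<subseteq> topspace X" if "e \<in> snd \<Gamma>" for e
    using embedding_map_image[of "top_of_set {0..1}" X "\<gamma> e"] * that
    by (simp add: graph_embedding_def)
  have gX': "\<gamma> e ` {0<..<1} \<subseteq> topspace X" if "e \<in> snd \<Gamma>" for e
  proof -
    have "{0<..<1::real} \<subseteq> {0..1}" by auto
    then show ?thesis using gX[OF that] by blast
  qed
  have dis: "h ` A \<inter> h ` B = {}" if "A \<inter> B = {}" "A \<subseteq> topspace X" "B \<subseteq> topspace X" for A B
    using inj_on_image_Int[OF inj that(2,3)] that(1) by simp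
  have "graph_embedding \<Gamma> Y (h \<circ> p) (\<lambda>e. h \<circ> \<gamma> e)"
    unfolding graph_embedding_def
  proof (intro conjI ballI impI)
    show "(h \<circ> p) ` fst \<Gamma> \<subseteq> topspace Y" using pX sub by auto
    show "inj_on (h \<circ> p) (fst \<Gamma>)"
      using * inj pX by (auto simp: graph_embedding_def intro: comp_inj_on inj_on_subset)
  next
    fix e assume e: "e \<in> snd \<Gamma>"
    show "embedding_map (top_of_set {0..1}) Y (h \<circ> \<gamma> e)"
      using * e assms(2) by (auto simp: graph_embedding_def intro: embedding_map_compose)
    have "{\<gamma> e 0, \<gamma> e 1} = p ` e" using * e by (simp add: graph_embedding_def)
    then have "h ` {\<gamma> e 0, \<gamma> e 1} = h ` p ` e" by (rule arg_cong)
    then show "{(h \<circ> \<gamma> e) 0, (h \<circ> \<gamma> e) 1} = (h \<circ> p) ` e" by (simp add: image_comp)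
    have "\<gamma> e ` {0<..<1} \<inter> p ` fst \<Gamma> = {}" using * e by (simp add: graph_embedding_def)
    from dis[OF this gX'[OF e] pX]
    show "(h \<circ> \<gamma> e) ` {0<..<1} \<inter> (h \<circ> p) ` fst \<Gamma> = {}" by (simp add: image_comp)
  next
    fix e e' assume e: "e \<in> snd \<Gamma>" "e' \<in> snd \<Gamma>" "e \<noteq> e'"
    then have "\<gamma> e ` {0<..<1} \<inter> \<gamma> e' ` {0<..<1} = {}" using * by (simp add: graph_embedding_def)
    from dis[OF this gX'[OF e(1)] gX'[OF e(2)]]
    show "(h \<circ> \<gamma> e) ` {0<..<1} \<inter> (h \<circ> \<gamma> e') ` {0<..<1} = {}" by (simp add: image_comp)
  qed
  then show ?thesis unfolding embeds_in_def by blast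
qed

lemma embeds_in_homeomorphic:
  assumes "X homeomorphic_space Y" "embeds_in \<Gamma> X"
  shows "embeds_in \<Gamma> Y"
proof -
  obtain h where "homeomorphic_map X Y h" using assms(1) by (auto simp: homeomorphic_space)
  then have "embedding_map X Y h"
    by (metis embedding_map_def homeomorphic_imp_surjective_map subtopology_topspace)
  then show ?thesis using embeds_in_compose_embedding assms(2) by blast
qed

lemma embeds_in_N_1: "embeds_in_N \<Gamma> 1 \<longleftrightarrow> embeds_in \<Gamma> projective_plane"
  unfolding embeds_in_N_def One_nat_def is_N.simps
  using embeds_in_homeomorphic homeomorphic_space_refl by blast

lemma embeds_in_N_0: "embeds_in_N \<Gamma> 0 \<longleftrightarrow> embeds_in \<Gamma> sphere2"
proof -
  define S where "S = pullback_topology (range (\<lambda>x::real^3. {x})) the_elem sphere2"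
  have top: "topspace S = (\<lambda>x. {x}) ` sphere 0 1"
    unfolding S_def topspace_pullback_topology by auto
  have "homeomorphic_maps S sphere2 the_elem (\<lambda>x. {x})"
    unfolding homeomorphic_maps_def
  proof (intro conjI ballI)
    show "continuous_map S sphere2 the_elem"
      unfolding S_def using continuous_map_pullback[of sphere2 sphere2 id]
      by (simp add: id_def comp_def)
    show "continuous_map sphere2 S (\<lambda>x. {x})"
      unfolding S_def by (rule continuous_map_pullback') (auto simp: comp_def)
  qed (auto simp: top)
  then have "is_N 0 S" by (auto simp: homeomorphic_space_def)
  then have "S homeomorphic_space sphere2" by simp
  then have "embeds_in_N \<Gamma> 0" if "embeds_in \<Gamma> sphere2"
    using embeds_in_homeomorphic[OF _ that, of S] homeomorphic_space_sym[of S sphere2]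
    unfolding embeds_in_N_def is_N.simps by blast
  moreover have "embeds_in \<Gamma> sphere2" if N0: "embeds_in_N \<Gamma> 0"
  proof -
    obtain X :: "(real^3) set topology" where "X homeomorphic_space sphere2" "embeds_in \<Gamma> X"
      using N0 unfolding embeds_in_N_def is_N.simps by blast
    then show ?thesis by (rule embeds_in_homeomorphic)
  qed
  ultimately show ?thesis by (rule iffI[rotated])
qed

lemma projective_iff:
  "projective \<Gamma> \<longleftrightarrow> embeds_in \<Gamma> projective_plane \<and> \<not> embeds_in \<Gamma> sphere2"
  unfolding projective_def has_crosscap_def embeds_in_N_1 by (simp add: embeds_in_N_0)

end

theory Submission
  imports Defs
begin

text \<open>
  If no two elements generate a non-solvable subgroup, the graph is empty and hence planar.
  Otherwise it contains \<open>K\<^bsub>3,6\<^esub>\<close>, which does not embed in the projective plane.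

  A group generated by two involutions is dihedral, hence solvable; so a pair generating a
  non-solvable group can be replaced by one, \<open>x, y\<close>, in which neither member is an involution.
  Each of \<open>x, x\<inverse>, y\<close> generates the same subgroup together with any of \<open>(xy)\<^sup>\<plusminus>, (yx)\<^sup>\<plusminus>, xy\<inverse>, y\<inverse>x\<close>, and a
  coincidence among these six words makes \<open>\<langle>x, y\<rangle>\<close> metacyclic, unless \<open>xy\<close> is an involution. In that
  case \<open>y\<close> is replaced by \<open>y\<inverse>\<close>; if \<open>xy\<inverse>\<close> is an involution as well, then \<open>\<langle>x, y\<rangle>\<close> is polycyclic,
  through \<open>\<langle>y\<^sup>2\<rangle> \<lhd> \<langle>y\<^sup>2, x\<rangle> \<lhd> \<langle>x, y\<rangle>\<close>.

  An embedding of \<open>K\<^bsub>3,6\<^esub>\<close> in the projective plane lifts to an antipodally symmetric drawing on the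
  sphere, in which every lift of one of the six vertices is joined to exactly one of the two lifts
  of each of the three vertices. By the pigeonhole principle this drawing contains a subdivision
  of \<open>K\<^bsub>3,3\<^esub>\<close> avoiding some point. Finally \<open>K\<^bsub>3,3\<^esub>\<close> is not planar by the theorems of Jordan and
  Janiszewski.
\<close>

section \<open>Pairs generating a non-solvable subgroup\<close>

context group
begin

section \<open>Solvability of a subgroup extended by a normalizing element\<close>

lemma inv_mult_cancel_left:
  assumes "x \<in> carrier G" "y \<in> carrier G"
  shows "inv x \<otimes> (x \<otimes> y) = y" "x \<otimes> (inv x \<otimes> y) = y"
  using assms by (simp_all add: m_assoc[symmetric])

lemmas word_simps = m_assoc inv_mult_group inv_mult_cancel_left

text \<open>The derived series of H is the same computed in H or in the ambient group, so
  solvability of subgroups can be treated without changing the group structure.\<close>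

lemma solvable_subgroup_iff:
  assumes "subgroup H G"
  shows "solvable (G\<lparr>carrier := H\<rparr>) \<longleftrightarrow> solvable_seq G H"
proof -
  interpret H: group "G\<lparr>carrier := H\<rparr>" using assms by (rule subgroup_imp_group)
  have "(derived G ^^ n) H \<subseteq> H" for n
    using derived_incl[OF _ assms] by (induction n) auto
  then have "(derived (G\<lparr>carrier := H\<rparr>) ^^ n) H = (derived G ^^ n) H" for n
    using derived_consistent[OF _ assms] by (induction n) auto
  then show ?thesis
    using H.solvable_iff_trivial_derived_seq solvable_imp_trivial_derived_seq[of H]
      trivial_derived_seq_imp_solvable[OF assms]
    by auto
qed

text \<open>Both directions of conjugation are demanded because, for infinite K, g K g^-1 being
  contained in K says nothing about g^-1.\<close>

lemma normalizer_subgroup: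
  assumes "K \<subseteq> carrier G"
  shows "subgroup {g \<in> carrier G. \<forall>k\<in>K. g \<otimes> k \<otimes> inv g \<in> K \<and> inv g \<otimes> k \<otimes> g \<in> K} G"
proof (rule subgroupI)
  fix g h
  assume g: "g \<in> {g \<in> carrier G. \<forall>k\<in>K. g \<otimes> k \<otimes> inv g \<in> K \<and> inv g \<otimes> k \<otimes> g \<in> K}"
    and h: "h \<in> {g \<in> carrier G. \<forall>k\<in>K. g \<otimes> k \<otimes> inv g \<in> K \<and> inv g \<otimes> k \<otimes> g \<in> K}"
  have "(g \<otimes> h) \<otimes> k \<otimes> inv (g \<otimes> h) = g \<otimes> (h \<otimes> k \<otimes> inv h) \<otimes> inv g"
    "inv (g \<otimes> h) \<otimes> k \<otimes> (g \<otimes> h) = inv h \<otimes> (inv g \<otimes> k \<otimes> g) \<otimes> h" if "k \<in> K" for k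
    using g h assms that by (auto simp: word_simps subset_iff)
  then show "g \<otimes> h \<in> {g \<in> carrier G. \<forall>k\<in>K. g \<otimes> k \<otimes> inv g \<in> K \<and> inv g \<otimes> k \<otimes> g \<in> K}"
    using g h by auto
qed (use assms in \<open>auto simp: subset_iff intro!: exI[of _ \<one>]\<close>)

text \<open>With [a,h] = a h a^-1 h^-1, closure comes from [a,gh] = [a,g] * g [a,h] g^-1 and
  [a,h^-1] = h^-1 [a,h]^-1 h. It allows commutators modulo K to be tested on generators
  only.\<close>

lemma commuting_mod_subgroup:
  assumes K: "subgroup K G" and "a \<in> carrier G" and H: "subgroup H G"
    and nrm: "\<And>h k. h \<in> H \<Longrightarrow> k \<in> K \<Longrightarrow> h \<otimes> k \<otimes> inv h \<in> K"
  shows "subgroup {h \<in> H. a \<otimes> h \<otimes> inv a \<otimes> inv h \<in> K} G"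
proof (rule subgroupI)
  note Hc = subgroup.mem_carrier[OF H] and Kc = subgroup.mem_carrier[OF K]
  show "{h \<in> H. a \<otimes> h \<otimes> inv a \<otimes> inv h \<in> K} \<subseteq> carrier G" using Hc by auto
  show "{h \<in> H. a \<otimes> h \<otimes> inv a \<otimes> inv h \<in> K} \<noteq> {}"
    using assms(2) subgroup.one_closed[OF H] subgroup.one_closed[OF K] by auto
next
  fix h assume h: "h \<in> {h \<in> H. a \<otimes> h \<otimes> inv a \<otimes> inv h \<in> K}"
  then have hH: "h \<in> H" "inv h \<in> H" "h \<in> carrier G"
    using subgroup.m_inv_closed[OF H] subgroup.mem_carrier[OF H] by auto
  have "inv h \<otimes> inv (a \<otimes> h \<otimes> inv a \<otimes> inv h) \<otimes> inv (inv h) \<in> K"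
    using h nrm[OF hH(2)] subgroup.m_inv_closed[OF K] by blast
  then show "inv h \<in> {h \<in> H. a \<otimes> h \<otimes> inv a \<otimes> inv h \<in> K}"
    using hH assms(2) by (simp add: word_simps)
next
  fix g h assume gh: "g \<in> {h \<in> H. a \<otimes> h \<otimes> inv a \<otimes> inv h \<in> K}" "h \<in> {h \<in> H. a \<otimes> h \<otimes> inv a \<otimes> inv h \<in> K}"
  then have c: "g \<in> carrier G" "h \<in> carrier G" "g \<otimes> h \<in> H"
    using subgroup.mem_carrier[OF H] subgroup.m_closed[OF H] by auto
  have "(a \<otimes> g \<otimes> inv a \<otimes> inv g) \<otimes> (g \<otimes> (a \<otimes> h \<otimes> inv a \<otimes> inv h) \<otimes> inv g) \<in> K"
    using gh nrm subgroup.m_closed[OF K] by blast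
  then show "g \<otimes> h \<in> {h \<in> H. a \<otimes> h \<otimes> inv a \<otimes> inv h \<in> K}"
    using c assms(2) by (simp add: word_simps)
qed

text \<open>K is normal in H = <K, y> with cyclic, hence abelian, quotient. Commutators modulo K
  replace the quotient group: they show that the derived subgroup of H lies in K.\<close>

lemma solvable_seq_insert_subgroup:
  assumes sol: "solvable_seq G K" and y: "y \<in> carrier G"
    and nrm: "\<And>k. k \<in> K \<Longrightarrow> y \<otimes> k \<otimes> inv y \<in> K" "\<And>k. k \<in> K \<Longrightarrow> inv y \<otimes> k \<otimes> y \<in> K"
  shows "solvable_seq G (generate G (insert y K))"
proof -
  note K = solvable_imp_subgroup[OF sol]
  note Kc = subgroup.subset[OF K]
  define H where "H = generate G (insert y K)"
  have yK: "insert y K \<subseteq> carrier G" using y Kc by auto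
  have H: "subgroup H G" unfolding H_def using yK by (rule generate_is_subgroup)
  have inH: "insert y K \<subseteq> H" unfolding H_def by (auto intro: generate.incl)
  have KH: "h \<otimes> k \<otimes> inv h \<in> K" if "h \<in> H" "k \<in> K" for h k
  proof -
    have "insert y K \<subseteq> {g \<in> carrier G. \<forall>k\<in>K. g \<otimes> k \<otimes> inv g \<in> K \<and> inv g \<otimes> k \<otimes> g \<in> K}"
      using y nrm Kc subgroup.m_closed[OF K] subgroup.m_inv_closed[OF K] by auto
    from generate_subgroup_incl[OF this normalizer_subgroup[OF Kc]] that
    show ?thesis unfolding H_def by blast
  qed
  have comm: "a \<otimes> h \<otimes> inv a \<otimes> inv h \<in> K"
    if "a \<in> H" "insert y K \<subseteq> {h \<in> H. a \<otimes> h \<otimes> inv a \<otimes> inv h \<in> K}" "h \<in> H" for a h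
    using generate_subgroup_incl[OF that(2) commuting_mod_subgroup[OF K _ H KH]] that
      subgroup.mem_carrier[OF H] unfolding H_def by blast
  have commK: "a \<otimes> k \<otimes> inv a \<otimes> inv k \<in> K" if "a \<in> H" "k \<in> K" for a k
    using KH[OF that] that(2) subgroup.m_closed[OF K] subgroup.m_inv_closed[OF K] by blast
  have commy: "y \<otimes> h \<otimes> inv y \<otimes> inv h \<in> K" if "h \<in> H" for h
    using comm[of y h] commK[of y] that inH y subgroup.one_closed[OF K] by (auto simp: word_simps)
  \<comment> \<open>So far y commutes with all of H modulo K. As [a,y] is the inverse of [y,a],
    every a in H commutes modulo K with all generators of H.\<close>
  have "a \<otimes> h \<otimes> inv a \<otimes> inv h \<in> K" if "a \<in> H" "h \<in> H" for a h
  proof (rule comm[OF that(1) _ that(2)])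
    have "a \<in> carrier G" using that(1) subgroup.mem_carrier[OF H] by auto
    then have "inv (y \<otimes> a \<otimes> inv y \<otimes> inv a) = a \<otimes> y \<otimes> inv a \<otimes> inv y"
      using y by (simp add: word_simps)
    then have "a \<otimes> y \<otimes> inv a \<otimes> inv y \<in> K"
      using commy[OF that(1)] subgroup.m_inv_closed[OF K] by metis
    then show "insert y K \<subseteq> {h \<in> H. a \<otimes> h \<otimes> inv a \<otimes> inv h \<in> K}"
      using commK[OF that(1)] inH by auto
  qed
  then have "derived G H \<subseteq> K"
    unfolding derived_def by (intro generate_subgroup_incl[OF _ K]) auto
  moreover obtain n where n: "(derived G ^^ n) K = {\<one>}"
    using solvable_imp_trivial_derived_seq[OF sol] by blast
  ultimately have "(derived G ^^ n) (derived G H) \<subseteq> {\<one>}"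
    using mono_exp_of_derived by metis
  moreover have "\<one> \<in> (derived G ^^ n) (derived G H)"
    using exp_of_derived_is_subgroup[OF derived_is_subgroup[OF subgroup.subset[OF H]]] 
    by (rule subgroup.one_closed)
  ultimately have "(derived G ^^ Suc n) H = {\<one>}"
    by (auto simp: funpow_swap1)
  then show ?thesis using trivial_derived_seq_imp_solvable[OF H] unfolding H_def by blast
qed

lemma generate_eqI:
  assumes "A \<subseteq> carrier G" "B \<subseteq> carrier G" "A \<subseteq> generate G B" "B \<subseteq> generate G A"
  shows "generate G A = generate G B"
  using assms generate_subgroup_incl generate_is_subgroup by (meson subset_antisym)

text \<open>Conjugation is a homomorphism, so it suffices to check on generators that y normalizes
  <A>.\<close>

lemma solvable_seq_insert:
  assumes sol: "solvable_seq G (generate G A)" and A: "A \<subseteq> carrier G" and y: "y \<in> carrier G"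
    and nrm: "\<And>a. a \<in> A \<Longrightarrow> y \<otimes> a \<otimes> inv y \<in> generate G A" "\<And>a. a \<in> A \<Longrightarrow> inv y \<otimes> a \<otimes> y \<in> generate G A"
  shows "solvable_seq G (generate G (insert y A))"
proof -
  note K = generate_is_subgroup[OF A]
  note Kc = subgroup.mem_carrier[OF K]
  have conj: "g \<otimes> k \<otimes> inv g \<in> generate G A"
    if g: "g \<in> carrier G" "\<And>a. a \<in> A \<Longrightarrow> g \<otimes> a \<otimes> inv g \<in> generate G A" and "k \<in> generate G A" for g k
    using that(3)
  proof (induction rule: generate.induct)
    case one then show ?case using g(1) by (simp add: generate.one)
  next
    case (incl h) then show ?case using g(2) by blast
  next
    case (inv h)
    then have "inv (g \<otimes> h \<otimes> inv g) \<in> generate G A"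
      using g(2) subgroup.m_inv_closed[OF K] by blast
    then show ?case using g(1) inv A by (simp add: word_simps subset_iff)
  next
    case (eng h1 h2)
    then have "(g \<otimes> h1 \<otimes> inv g) \<otimes> (g \<otimes> h2 \<otimes> inv g) \<in> generate G A"
      using generate.eng by fast
    then show ?case using g(1) Kc[OF eng.hyps(1)] Kc[OF eng.hyps(2)] by (simp add: word_simps)
  qed
  have "generate G (insert y A) = generate G (insert y (generate G A))"
  proof (rule generate_eqI)
    show "insert y A \<subseteq> generate G (insert y (generate G A))"
      by (auto intro!: generate.incl)
    show "insert y (generate G A) \<subseteq> generate G (insert y A)"
      using mono_generate[of A "insert y A"] by (auto intro: generate.incl)
  qed (use A y Kc in auto)
  moreover have "solvable_seq G (generate G (insert y (generate G A)))"
    using solvable_seq_insert_subgroup[OF sol y] conj[of y] conj[of "inv y"] nrm y by simp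
  ultimately show ?thesis by simp
qed

lemma solvable_seq_generate_singleton:
  assumes "x \<in> carrier G" shows "solvable_seq G (generate G {x})"
  using solvable_seq_insert[of "{}" x] solvable_seq.unity[of G] assms by (simp add: generate_empty)

text \<open>The relation says that y x y^-1 is x or x^-1, so y normalizes the cyclic group
  <x>.\<close>

lemma solvable_seq_metacyclic:
  assumes "x \<in> carrier G" "y \<in> carrier G" "y \<otimes> x \<in> {x \<otimes> y, inv x \<otimes> y}"
  shows "solvable_seq G (generate G {x, y})"
proof -
  have "y \<otimes> x \<otimes> inv y \<in> {x \<otimes> y \<otimes> inv y, inv x \<otimes> y \<otimes> inv y}" using assms(3) by auto
  then have "y \<otimes> x \<otimes> inv y \<in> {x, inv x}" using assms(1,2) by (simp add: word_simps)
  moreover have "inv y \<otimes> x \<otimes> y \<in> {x, inv x}"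
  proof -
    have "x \<otimes> y \<in> {y \<otimes> x, y \<otimes> inv x}"
    proof (cases "y \<otimes> x = x \<otimes> y")
      case False
      then have "y \<otimes> x = inv x \<otimes> y" using assms by simp
      then have "x \<otimes> (y \<otimes> x) \<otimes> inv x = x \<otimes> (inv x \<otimes> y) \<otimes> inv x" by simp
      then show ?thesis using assms by (simp add: word_simps)
    qed simp
    then have "inv y \<otimes> (x \<otimes> y) \<in> {inv y \<otimes> (y \<otimes> x), inv y \<otimes> (y \<otimes> inv x)}" by auto
    then have "inv y \<otimes> (x \<otimes> y) \<in> {x, inv x}" using assms(1,2) by (simp add: word_simps)
    then show ?thesis using assms by (simp add: word_simps)
  qed
  moreover have "{x, inv x} \<subseteq> generate G {x}" by (auto intro: generate.incl generate.inv)
  ultimately show ?thesis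
    using solvable_seq_insert[OF solvable_seq_generate_singleton[OF assms(1)], of y] assms
    by (auto simp: insert_commute)
qed


section \<open>Words in a pair of elements that generates a non-solvable subgroup\<close>

abbreviation nonsol :: "'a \<Rightarrow> 'a \<Rightarrow> bool" where
  "nonsol x y \<equiv> \<not> solvable_seq G (generate G {x, y})"

lemma nonsol_sym: "nonsol x y \<Longrightarrow> nonsol y x"
  by (simp add: insert_commute)

lemma nonsol_subst:
  assumes "nonsol x y" "{x, y} \<subseteq> carrier G" "{u, v} \<subseteq> generate G {x, y}" "{x, y} \<subseteq> generate G {u, v}"
  shows "nonsol u v"
  using generate_eqI[of "{x, y}" "{u, v}"] generate_in_carrier[OF assms(2)] assms by auto

lemma generate_pair:
  "{x, y, inv x, inv y} \<subseteq> generate G {x, y}"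
  by (auto intro: generate.incl generate.inv)

lemma nonsol_inv_right:
  assumes "x \<in> carrier G" "y \<in> carrier G" "nonsol x y" shows "nonsol x (inv y)"
  using nonsol_subst[OF assms(3), of x "inv y"] assms(1,2) generate_pair[of x y] generate_pair[of x "inv y"]
  by simp

lemma nonsol_mult_right:
  assumes "x \<in> carrier G" "y \<in> carrier G" "nonsol x y" shows "nonsol x (x \<otimes> y)" "nonsol x (y \<otimes> x)"
proof -
  have "inv x \<otimes> (x \<otimes> y) \<in> generate G {x, x \<otimes> y}" "(y \<otimes> x) \<otimes> inv x \<in> generate G {x, y \<otimes> x}"
    using generate_pair[of x "x \<otimes> y"] generate_pair[of x "y \<otimes> x"] by (auto intro!: generate.eng)
  then have "y \<in> generate G {x, x \<otimes> y}" "y \<in> generate G {x, y \<otimes> x}"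
    using assms(1,2) by (simp_all add: word_simps)
  then show "nonsol x (x \<otimes> y)" "nonsol x (y \<otimes> x)"
    using nonsol_subst[OF assms(3), of x "x \<otimes> y"] nonsol_subst[OF assms(3), of x "y \<otimes> x"]
      generate.eng[of x G "{x, y}" y] generate.eng[of y G "{x, y}" x] generate_pair[of x y] assms(1,2)
      generate_pair[of x "x \<otimes> y"] generate_pair[of x "y \<otimes> x"]
    by simp_all
qed

lemma nonsol_words:
  assumes "x \<in> carrier G" "y \<in> carrier G" "nonsol x y"
  shows "nonsol x (x \<otimes> y)" "nonsol x (y \<otimes> x)" "nonsol x (inv y \<otimes> inv x)" "nonsol x (inv x \<otimes> inv y)"
    "nonsol x (x \<otimes> inv y)" "nonsol x (inv y \<otimes> x)"
proof -
  show 1: "nonsol x (x \<otimes> y)" "nonsol x (y \<otimes> x)" by (rule nonsol_mult_right[OF assms])+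
  show "nonsol x (x \<otimes> inv y)" "nonsol x (inv y \<otimes> x)"
    by (rule nonsol_mult_right[OF assms(1) inv_closed[OF assms(2)] nonsol_inv_right[OF assms]])+
  show "nonsol x (inv y \<otimes> inv x)" "nonsol x (inv x \<otimes> inv y)"
    using nonsol_inv_right[OF assms(1) _ 1(1)] nonsol_inv_right[OF assms(1) _ 1(2)] assms(1,2)
    by (simp_all add: inv_mult_group)
qed

text \<open>Each equality would produce a metacyclic pair: the first two make y normalize <x>, the
  third makes x normalize <y>, and x^2 = y^-2 makes x invert xy.\<close>

lemma nonsol_relations:
  assumes "x \<in> carrier G" "y \<in> carrier G" "nonsol x y"
  shows "y \<otimes> x \<noteq> x \<otimes> y" "y \<otimes> x \<noteq> inv x \<otimes> y" "x \<otimes> y \<noteq> inv y \<otimes> x" "x \<otimes> x \<noteq> inv y \<otimes> inv y"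
proof -
  show "y \<otimes> x \<noteq> x \<otimes> y" "y \<otimes> x \<noteq> inv x \<otimes> y"
    using solvable_seq_metacyclic[OF assms(1,2)] assms(3) by auto
  show "x \<otimes> y \<noteq> inv y \<otimes> x"
    using solvable_seq_metacyclic[OF assms(2,1)] assms(3) by (auto simp: insert_commute)
  show "x \<otimes> x \<noteq> inv y \<otimes> inv y"
  proof
    assume eq: "x \<otimes> x = inv y \<otimes> inv y"
    have "x \<otimes> (x \<otimes> y) = (x \<otimes> x) \<otimes> y" using assms(1,2) by (simp add: word_simps)
    also have "\<dots> = inv (x \<otimes> y) \<otimes> x" using assms(1,2) unfolding eq by (simp add: word_simps)
    finally have "solvable_seq G (generate G {x \<otimes> y, x})"
      using solvable_seq_metacyclic[of "x \<otimes> y" x] assms(1,2) by simp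
    then show False using nonsol_sym[OF nonsol_mult_right(1)[OF assms]] by simp
  qed
qed

text \<open>This is the dihedral case: two trivial squares would give x^2 = y^-2.\<close>

lemma nonsol_involution:
  assumes "x \<in> carrier G" "y \<in> carrier G" "nonsol x y" "inv x = x" shows "inv y \<noteq> y"
proof
  assume "inv y = y"
  then have "x \<otimes> x = \<one>" "inv y \<otimes> inv y = \<one>" using r_inv[of x] r_inv[of y] assms by simp_all
  then show False using nonsol_relations(4)[OF assms(1-3)] by simp
qed

lemma nonsol_not_both_involutions:
  assumes "x \<in> carrier G" "y \<in> carrier G" "nonsol x y" "inv (x \<otimes> y) = x \<otimes> y"
  shows "inv (x \<otimes> inv y) \<noteq> x \<otimes> inv y"
proof
  assume "inv (x \<otimes> inv y) = x \<otimes> inv y"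
  then have eq: "x \<otimes> y = inv y \<otimes> inv x" "x \<otimes> inv y = y \<otimes> inv x"
    using assms by (simp_all add: inv_mult_group)
  \<comment> \<open>The two relations make x invert z, so <x, z> is solvable. They also give y x
    y^-1 = z x^-1 and y^-1 x y = z^-1 x^-1, so y normalizes <x, z>.\<close>
  define z where "z = y \<otimes> y"
  have zc: "z \<in> carrier G" using assms by (simp add: z_def)
  have "x \<otimes> z \<otimes> inv x = (x \<otimes> y) \<otimes> (y \<otimes> inv x)" using assms(1,2) by (simp add: z_def word_simps)
  also have "\<dots> = inv z" using assms(1,2) unfolding eq(1) eq(2)[symmetric] by (simp add: z_def word_simps)
  finally have xz: "x \<otimes> z \<otimes> inv x = inv z" .
  have "z = inv x \<otimes> inv z \<otimes> x"
    using zc assms(1) unfolding xz[symmetric] by (simp add: word_simps)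
  then have xz': "inv x \<otimes> z \<otimes> x = inv z"
    using zc assms(1) by (metis inv_equality inv_inv inv_mult_group m_assoc m_closed inv_closed l_inv)
  have "solvable_seq G (generate G {x, z})"
    using solvable_seq_insert[OF solvable_seq_generate_singleton[OF zc], of x] xz xz' zc assms(1)
    by (auto intro: generate.inv)
  moreover have "y \<otimes> x \<otimes> inv y \<in> generate G {x, z}"
  proof -
    have "y \<otimes> x \<otimes> inv y = z \<otimes> inv x"
      using assms(1,2) eq(2) by (simp add: z_def m_assoc)
    then show ?thesis using generate_pair[of x z] by (auto intro: generate.eng)
  qed
  moreover have "inv y \<otimes> x \<otimes> y \<in> generate G {x, z}"
  proof -
    have "inv y \<otimes> x \<otimes> y = inv z \<otimes> inv x"
      using assms(1,2) eq(1) by (simp add: z_def m_assoc inv_mult_group)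
    then show ?thesis using generate_pair[of x z] by (auto intro: generate.eng)
  qed
  moreover have "y \<otimes> z \<otimes> inv y = z" "inv y \<otimes> z \<otimes> y = z"
    using assms(1,2) by (simp_all add: z_def word_simps)
  ultimately have "solvable_seq G (generate G {y, x, z})"
    using zc assms(1,2) generate_pair[of x z] by (intro solvable_seq_insert[of "{x, z}" y]) auto
  moreover have "generate G {y, x, z} = generate G {x, y}"
  proof (rule generate_eqI)
    show "{y, x, z} \<subseteq> generate G {x, y}"
      using generate_pair[of x y] generate.eng[of y G "{x, y}" y] by (auto simp: z_def)
  qed (use zc assms in \<open>auto intro: generate.incl\<close>)
  ultimately show False using assms(3) by simp
qed

lemma nonsol_K36_aux:
  assumes "x \<in> carrier G" "y \<in> carrier G" "nonsol x y"
    and ord: "inv x \<noteq> x" "inv y \<noteq> y" "inv (x \<otimes> y) \<noteq> x \<otimes> y"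
  shows "\<exists>A B. A \<subseteq> carrier G \<and> B \<subseteq> carrier G \<and> card A = 3 \<and> card B = 6 \<and> (\<forall>a\<in>A. \<forall>b\<in>B. nonsol a b)"
proof -
  define X Y where "X = inv x" "Y = inv y"
  have c: "x \<in> carrier G" "y \<in> carrier G" "X \<in> carrier G" "Y \<in> carrier G"
    and XY: "inv X = x" "inv Y = y" "inv x = X" "inv y = Y" using assms by (auto simp: X_Y_def)
  have cancel: "x \<otimes> X = \<one>" "X \<otimes> x = \<one>" "y \<otimes> Y = \<one>" "Y \<otimes> y = \<one>"
    "\<And>u. u \<in> carrier G \<Longrightarrow> x \<otimes> (X \<otimes> u) = u" "\<And>u. u \<in> carrier G \<Longrightarrow> X \<otimes> (x \<otimes> u) = u"
    "\<And>u. u \<in> carrier G \<Longrightarrow> y \<otimes> (Y \<otimes> u) = u" "\<And>u. u \<in> carrier G \<Longrightarrow> Y \<otimes> (y \<otimes> u) = u"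
    using assms(1,2) by (auto simp: X_Y_def m_assoc[symmetric])
  note rel = nonsol_relations[OF assms(1-3), unfolded XY]
  define A where "A = {x, X, y}"
  define B where "B = {x \<otimes> y, Y \<otimes> X, y \<otimes> x, X \<otimes> Y, x \<otimes> Y, Y \<otimes> x}"
  have ord': "X \<noteq> x" "Y \<noteq> y" "Y \<otimes> X \<noteq> x \<otimes> y" using ord by (auto simp: X_Y_def inv_mult_group assms)
  have yx: "nonsol y x" using nonsol_sym[OF assms(3)] .
  have Xn: "nonsol X u" if "nonsol x u" "u \<in> carrier G" for u
    using nonsol_sym[OF nonsol_inv_right[OF that(2) c(1) nonsol_sym[OF that(1)]]] unfolding XY .
  \<comment> \<open>For y, the pair (y, x) supplies the first four words of \<open>B\<close>; the
    words x Y and Y x come from the pair (y, X).\<close>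
  have "\<forall>b\<in>B. nonsol x b" "\<forall>b\<in>B. nonsol y b"
    using nonsol_words[OF assms(1-3), unfolded XY] nonsol_words[OF assms(2,1) yx, unfolded XY]
      nonsol_words[OF assms(2) inv_closed[OF assms(1)] nonsol_inv_right[OF assms(2,1) yx], unfolded XY]
    by (auto simp: B_def)
  moreover have "B \<subseteq> carrier G" "A \<subseteq> carrier G" using c by (auto simp: A_def B_def)
  ultimately have "\<forall>a\<in>A. \<forall>b\<in>B. nonsol a b" using Xn by (auto simp: A_def)
  moreover have "card A = 3"
  proof -
    have "x \<noteq> y" "X \<noteq> y" using rel(1) cancel by auto
    then show ?thesis using ord' by (simp add: A_def)
  qed
  moreover have "card B = 6"
  proof -
    \<comment> \<open>Of the 15 pairs of words one is separated by \<open>ord'(3)\<close>. In the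
      others, cancellation reduces equality to a relation excluded by
      \<open>nonsol_relations\<close> or by \<open>ord'\<close>.\<close>
    have 1: "x \<otimes> y \<noteq> y \<otimes> x" using rel(1) by auto
    have 2: "x \<otimes> y \<noteq> X \<otimes> Y"
    proof
      assume "x \<otimes> y = X \<otimes> Y"
      then have "x \<otimes> (x \<otimes> y) \<otimes> Y = x \<otimes> (X \<otimes> Y) \<otimes> Y" by simp
      then show False using rel(4) c by (simp add: m_assoc cancel)
    qed
    have 3: "x \<otimes> y \<noteq> x \<otimes> Y" "Y \<otimes> X \<noteq> Y \<otimes> x" "y \<otimes> x \<noteq> Y \<otimes> x" using ord' c by auto
    have 4: "x \<otimes> y \<noteq> Y \<otimes> x" using rel(3) .
    have 5: "Y \<otimes> X \<noteq> y \<otimes> x"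
    proof
      assume "Y \<otimes> X = y \<otimes> x"
      then have "y \<otimes> (Y \<otimes> X) \<otimes> X = y \<otimes> (y \<otimes> x) \<otimes> X" by simp
      then have "X \<otimes> X = y \<otimes> y" using c by (simp add: m_assoc cancel)
      then show False using nonsol_relations(4)[OF assms(2,1) yx] unfolding XY by simp
    qed
    have 6: "Y \<otimes> X \<noteq> X \<otimes> Y"
    proof
      assume "Y \<otimes> X = X \<otimes> Y"
      then have "y \<otimes> x \<otimes> (Y \<otimes> X) \<otimes> x \<otimes> y = y \<otimes> x \<otimes> (X \<otimes> Y) \<otimes> x \<otimes> y" by simp
      then show False using rel(1) c by (simp add: m_assoc cancel)
    qed
    have 7: "Y \<otimes> X \<noteq> x \<otimes> Y"
    proof
      assume "Y \<otimes> X = x \<otimes> Y"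
      then have "y \<otimes> (Y \<otimes> X) \<otimes> y = y \<otimes> (x \<otimes> Y) \<otimes> y" by simp
      then show False using rel(2) c by (simp add: m_assoc cancel)
    qed
    have 8: "y \<otimes> x \<noteq> X \<otimes> Y"
    proof
      assume "y \<otimes> x = X \<otimes> Y"
      then have "Y \<otimes> (y \<otimes> x) \<otimes> y = Y \<otimes> (X \<otimes> Y) \<otimes> y" by simp
      then show False using ord'(3) c by (simp add: m_assoc cancel)
    qed
    have 9: "y \<otimes> x \<noteq> x \<otimes> Y"
    proof
      assume "y \<otimes> x = x \<otimes> Y"
      then have "Y \<otimes> (y \<otimes> x) \<otimes> y = Y \<otimes> (x \<otimes> Y) \<otimes> y" by simp
      then show False using rel(3) c by (simp add: m_assoc cancel)
    qed
    have 10: "X \<otimes> Y \<noteq> x \<otimes> Y" using ord' c by auto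
    have 11: "X \<otimes> Y \<noteq> Y \<otimes> x"
    proof
      assume "X \<otimes> Y = Y \<otimes> x"
      then have "y \<otimes> (X \<otimes> Y) \<otimes> y = y \<otimes> (Y \<otimes> x) \<otimes> y" by simp
      then have "x \<otimes> (y \<otimes> X) \<otimes> x = x \<otimes> (x \<otimes> y) \<otimes> x" using c by (simp add: m_assoc cancel)
      then have eq: "x \<otimes> y = x \<otimes> (x \<otimes> (y \<otimes> x))" using c by (simp add: m_assoc cancel)
      have "X \<otimes> (x \<otimes> y) = X \<otimes> (x \<otimes> (x \<otimes> (y \<otimes> x)))" using eq by simp
      then have "X \<otimes> y = X \<otimes> (x \<otimes> (y \<otimes> x))" using c by (simp add: m_assoc cancel)
      then show False using rel(2) c by (simp add: m_assoc cancel)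
    qed
    have 12: "x \<otimes> Y \<noteq> Y \<otimes> x"
    proof
      assume "x \<otimes> Y = Y \<otimes> x"
      then have "y \<otimes> (x \<otimes> Y) \<otimes> y = y \<otimes> (Y \<otimes> x) \<otimes> y" by simp
      then show False using rel(1) c by (simp add: m_assoc cancel)
    qed
    show ?thesis
      unfolding B_def using 1 2 3 4 5 6 7 8 9 10 11 12 ord' by (simp add: eq_commute)
  qed
  ultimately show ?thesis using \<open>A \<subseteq> carrier G\<close> \<open>B \<subseteq> carrier G\<close> by blast
qed

lemma nonsol_K36:
  assumes "x \<in> carrier G" "y \<in> carrier G" "nonsol x y"
  shows "\<exists>A B. A \<subseteq> carrier G \<and> B \<subseteq> carrier G \<and> card A = 3 \<and> card B = 6 \<and> (\<forall>a\<in>A. \<forall>b\<in>B. nonsol a b)"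
proof -
  have "\<exists>u v. u \<in> carrier G \<and> v \<in> carrier G \<and> nonsol u v \<and> inv u \<noteq> u \<and> inv v \<noteq> v"
  proof -
    \<comment> \<open>If x is an involution, then y and xy are not, since each forms a non-solvable
      pair with x; the pair (y, xy) is therefore free of involutions.\<close>
    have *: "\<exists>u v. u \<in> carrier G \<and> v \<in> carrier G \<and> nonsol u v \<and> inv u \<noteq> u \<and> inv v \<noteq> v"
      if "x \<in> carrier G" "y \<in> carrier G" "nonsol x y" "inv x = x" for x y
    proof (intro exI conjI)
      show "nonsol y (x \<otimes> y)"
        by (rule nonsol_mult_right(2)[OF that(2,1) nonsol_sym[OF that(3)]])
      show "inv y \<noteq> y" "inv (x \<otimes> y) \<noteq> x \<otimes> y"
        using nonsol_involution[of x y] nonsol_involution[of x "x \<otimes> y"] that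
          nonsol_mult_right(1)[of x y] by auto
    qed (use that in auto)
    show ?thesis
      using *[OF assms] *[OF assms(2,1) nonsol_sym[OF assms(3)]] assms
      by (cases "inv x = x"; cases "inv y = y") blast+
  qed
  then obtain u v where uv: "u \<in> carrier G" "v \<in> carrier G" "nonsol u v" "inv u \<noteq> u" "inv v \<noteq> v"
    by blast
  show ?thesis
  proof (cases "inv (u \<otimes> v) = u \<otimes> v")
    case True
    show ?thesis
      using nonsol_K36_aux[OF uv(1) inv_closed[OF uv(2)] nonsol_inv_right[OF uv(1-3)] uv(4) _
          nonsol_not_both_involutions[OF uv(1-3) True]] uv(2,5) by simp
  next
    case False
    show ?thesis by (rule nonsol_K36_aux[OF uv False])
  qed
qed

end

section \<open>Non-planarity of \<open>K\<^bsub>3,3\<^esub>\<close>\<close>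

text \<open>Edges are compact path-connected sets instead of arcs, so that a subdivided edge can
  simply be a union of edges. Arcs are extracted in \<open>K33_not_planar\<close>.\<close>

definition K33_drawing :: "(nat \<Rightarrow> 'a::topological_space) \<Rightarrow> (nat \<Rightarrow> 'a) \<Rightarrow> (nat \<Rightarrow> nat \<Rightarrow> 'a set) \<Rightarrow> bool" where
  "K33_drawing a b P \<longleftrightarrow>
     (\<forall>i<3. \<forall>j<3. compact (P i j) \<and> path_connected (P i j) \<and> a i \<in> P i j \<and> b j \<in> P i j) \<and>
     (\<forall>i<3. \<forall>j<3. \<forall>i'<3. \<forall>j'<3. (i, j) \<noteq> (i', j') \<longrightarrow>
        P i j \<inter> P i' j' \<subseteq> {z. i = i' \<and> z = a i \<or> j = j' \<and> z = b j})"

lemma K33_drawing_D: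
  assumes "K33_drawing a b P" "i < 3" "j < 3"
  shows "compact (P i j)" "path_connected (P i j)" "a i \<in> P i j" "b j \<in> P i j"
  using assms unfolding K33_drawing_def by blast+

lemma K33_drawing_Int:
  assumes "K33_drawing a b P" "i < 3" "j < 3" "i' < 3" "j' < 3" "z \<in> P i j" "z \<in> P i' j'"
    "i \<noteq> i' \<or> j \<noteq> j'"
  shows "i = i' \<and> z = a i \<or> j = j' \<and> z = b j"
  using assms unfolding K33_drawing_def by blast

text \<open>Inside and outside play symmetric roles: E is whichever side contains the connected set
  T.\<close>

lemma Jordan_curve_sides:
  fixes c :: "real \<Rightarrow> complex"
  assumes "simple_path c" "pathfinish c = pathstart c" "connected T" "T \<noteq> {}" "T \<inter> path_image c = {}"
  obtains D E where "D \<noteq> {}" "open D" "connected D" "open E" "connected E" "D \<inter> E = {}"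
    "D \<union> E = - path_image c" "frontier D = path_image c" "T \<subseteq> E"
proof -
  obtain I U where IU: "I \<noteq> {}" "open I" "connected I" "U \<noteq> {}" "open U" "connected U" "I \<inter> U = {}"
    "I \<union> U = - path_image c" "frontier I = path_image c" "frontier U = path_image c"
    using Jordan_curve[OF assms(1,2)] by metis
  have "T \<subseteq> I \<union> U" using IU(8) assms(5) by blast
  then have "I \<inter> T = {} \<or> U \<inter> T = {}"
    using connectedD[OF assms(3) IU(2,5)] IU(7) by blast
  then have "T \<subseteq> U \<or> T \<subseteq> I" using \<open>T \<subseteq> I \<union> U\<close> by blast
  then show thesis
    using that[of I U] that[of U I] IU by (metis Int_commute Un_commute)
qed

text \<open>The arcs \<open>c j\<close> from \<open>a 0\<close> to \<open>a 1\<close> through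
  \<open>b j\<close> form a theta graph, and the arcs \<open>q j\<close> form a tripod from
  \<open>a 2\<close> to the points \<open>b j\<close>. \<open>J l\<close> is the Jordan curve made
  of the two arcs other than \<open>c l\<close>; its side \<open>E l\<close> is the one that
  contains \<open>a 2\<close>.\<close>

lemma K33_not_planar:
  fixes a :: "nat \<Rightarrow> complex"
  assumes K: "K33_drawing a b P"
  shows False
proof -
  note D = K33_drawing_D[OF K] and I = K33_drawing_Int[OF K]
  \<comment> \<open>Vertices are distinct because edges without a common end are disjoint.\<close>
  have aa: "a i \<noteq> a i'" if "i < 3" "i' < 3" "i \<noteq> i'" for i i'
    using I[of i 0 i' 1 "a i"] D(3)[of i 0] D(3)[of i' 1] that by auto
  have ab: "a i \<noteq> b j" if "i < 3" "j < 3" for i j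
  proof
    assume eq: "a i = b j"
    obtain i' j' :: nat where "i' < 3" "i' \<noteq> i" "j' < 3" "j' \<noteq> j"
      by (metis One_nat_def less_numeral_extra(1) numeral_3_eq_3 not_less_eq zero_neq_one
          less_Suc_eq zero_less_Suc)
    then show False using I[of i j' i' j "a i"] D(3)[of i j'] D(4)[of i' j] that eq by auto
  qed
  have "\<exists>c. arc c \<and> path_image c \<subseteq> P 0 j \<union> P 1 j \<and> pathstart c = a 0 \<and> pathfinish c = a 1
      \<and> b j \<in> path_image c" if j: "j < 3" for j
  proof -
    have pc: "path_connected (P 0 j \<union> P 1 j)"
      using D(2,4)[of 0 j] D(2,4)[of 1 j] j by (intro path_connected_Un) auto
    obtain c where c: "arc c" "path_image c \<subseteq> P 0 j \<union> P 1 j" "pathstart c = a 0" "pathfinish c = a 1"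
      using pc D(3)[of 0 j] D(3)[of 1 j] j aa[of 0 1] unfolding path_connected_arcwise by force
    \<comment> \<open>The closed sets \<open>P 0 j\<close> and \<open>P 1 j\<close> meet at most in
      \<open>b j\<close>, so an arc avoiding \<open>b j\<close> would be disconnected by
      them.\<close>
    have "b j \<in> path_image c"
    proof (rule ccontr)
      assume nb: "b j \<notin> path_image c"
      have cl: "closed (P 0 j)" "closed (P 1 j)" using D(1) j by (auto intro: compact_imp_closed)
      have "connected (path_image c)" using c(1) by (simp add: connected_arc_image)
      moreover have "P 0 j \<inter> P 1 j \<inter> path_image c = {}" using I[of 0 j 1 j] j nb by auto
      moreover have "a 0 \<in> P 0 j \<inter> path_image c" "a 1 \<in> P 1 j \<inter> path_image c"
        using c D(3) j pathstart_in_path_image[of c] pathfinish_in_path_image[of c] by auto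
      ultimately show False using cl c(2) unfolding connected_closed by blast
    qed
    with c show ?thesis by blast
  qed
  then obtain c where c: "\<And>j. j < 3 \<Longrightarrow> arc (c j) \<and> path_image (c j) \<subseteq> P 0 j \<union> P 1 j \<and>
      pathstart (c j) = a 0 \<and> pathfinish (c j) = a 1 \<and> b j \<in> path_image (c j)"
    by metis
  have "\<exists>q. arc q \<and> path_image q \<subseteq> P 2 j \<and> pathstart q = a 2 \<and> pathfinish q = b j" if "j < 3" for j
    using D(2,3,4)[of 2 j] ab[of 2 j] that unfolding path_connected_arcwise by auto
  then obtain q where q: "\<And>j. j < 3 \<Longrightarrow> arc (q j) \<and> path_image (q j) \<subseteq> P 2 j \<and>
      pathstart (q j) = a 2 \<and> pathfinish (q j) = b j"
    by metis
  have cc: "path_image (c j) \<inter> path_image (c k) = {a 0, a 1}" if "j < 3" "k < 3" "j \<noteq> k" for j k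
  proof
    show "path_image (c j) \<inter> path_image (c k) \<subseteq> {a 0, a 1}"
    proof
      fix x assume "x \<in> path_image (c j) \<inter> path_image (c k)"
      then have "x \<in> P 0 j \<union> P 1 j" "x \<in> P 0 k \<union> P 1 k"
        using c[OF that(1)] c[OF that(2)] by blast+
      then show "x \<in> {a 0, a 1}"
        using I[of 0 j 0 k x] I[of 0 j 1 k x] I[of 1 j 0 k x] I[of 1 j 1 k x] that by auto
    qed
    show "{a 0, a 1} \<subseteq> path_image (c j) \<inter> path_image (c k)"
      using c[OF that(1)] c[OF that(2)] pathstart_in_path_image pathfinish_in_path_image by fastforce
  qed
  have qc: "path_image (q j) \<inter> path_image (c k) \<subseteq> (if j = k then {b j} else {})" if "j < 3" "k < 3" for j k
  proof
    fix x assume "x \<in> path_image (q j) \<inter> path_image (c k)"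
    then have "x \<in> P 2 j" "x \<in> P 0 k \<union> P 1 k"
      using c[OF that(2)] q[OF that(1)] by blast+
    then show "x \<in> (if j = k then {b j} else {})"
      using I[of 2 j 0 k x] I[of 2 j 1 k x] that by auto
  qed
  \<comment> \<open>The tripod without its feet, which is disjoint from the theta graph.\<close>
  define T where "T = (\<Union>j<3. path_image (q j) - {b j})"
  have a2: "a 2 \<in> path_image (q j) - {b j}" if "j < 3" for j
    using q[OF that] ab[of 2 j] that pathstart_in_path_image[of "q j"] by auto
  have conq: "connected (path_image (q j) - {b j})" if "j < 3" for j
  proof -
    have arc: "inj_on (q j) {0..1}" "continuous_on {0..1} (q j)" "b j = q j 1"
      using q[OF that] by (auto simp: arc_def path_def pathfinish_def)
    have "path_image (q j) - {b j} = q j ` {0..<1}"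
    proof -
      have "{0..<1::real} = {0..1} - {1}" by auto
      then show ?thesis
        using inj_on_image_set_diff[OF arc(1), of "{0..1}" "{1}"] by (simp add: path_image_def arc(3))
    qed
    moreover have "continuous_on {0..<1} (q j)"
      by (rule continuous_on_subset[OF arc(2)]) auto
    ultimately show ?thesis
      using connected_continuous_image[of "{0..<1}" "q j"] by simp
  qed
  have conT: "connected T"
    unfolding T_def
  proof (rule connected_Union)
    show "connected S" if "S \<in> (\<lambda>j. path_image (q j) - {b j}) ` {..<3}" for S
      using that conq by auto
    show "\<Inter> ((\<lambda>j. path_image (q j) - {b j}) ` {..<3}) \<noteq> {}"
    proof -
      have "a 2 \<in> \<Inter> ((\<lambda>j. path_image (q j) - {b j}) ` {..<3})"
        by (rule INT_I) (use a2 in simp)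
      then show ?thesis by (metis empty_iff)
    qed
  qed
  have a2T: "a 2 \<in> T" unfolding T_def by (rule UN_I[of 0]) (use a2[of 0] in simp_all)
  \<comment> \<open>Adding the foot \<open>b l\<close> and the open arc of \<open>c l\<close> keeps
    the set connected and off \<open>J l\<close>, so the tripod and \<open>c l\<close> are on the
    same side of \<open>J l\<close>.\<close>
  define T' where "T' l = (T \<union> path_image (q l)) \<union> (path_image (c l) - {a 0, a 1})" for l
  define J where "J l = (\<Union>j\<in>{..<3} - {l}. path_image (c j))" for l :: nat
  have bc: "b l \<in> path_image (c l) - {a 0, a 1}" if "l < 3" for l
    using c[OF that] ab[of 0 l] ab[of 1 l] that by auto
  have bq: "b l \<in> path_image (q l)" if "l < 3" for l
    using q[OF that] pathfinish_in_path_image by metis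
  have conT': "connected (T' l)" if "l < 3" for l
  proof -
    have 1: "connected (T \<union> path_image (q l))"
      using conT a2T a2[OF that] q[OF that] by (intro connected_Un) (auto simp: connected_arc_image)
    have 2: "connected (path_image (c l) - {a 0, a 1})"
      using connected_simple_path_endless[of "c l"] c[OF that] by (simp add: arc_imp_simple_path)
    show ?thesis
      unfolding T'_def using bc[OF that] bq[OF that] by (intro connected_Un[OF 1 2]) auto
  qed
  have TJ: "T' l \<inter> J l = {}" if "l < 3" for l
  proof -
    have "x \<notin> path_image (c k)" if "x \<in> T' l" "k < 3" "k \<noteq> l" for x k
    proof -
      consider j where "j < 3" "x \<in> path_image (q j) - {b j}" | "x \<in> path_image (q l)"
        | "x \<in> path_image (c l) - {a 0, a 1}"
        using \<open>x \<in> T' l\<close> unfolding T'_def T_def by auto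
      then show ?thesis
      proof cases
        case 1
        then show ?thesis using qc[OF 1(1) that(2)] by (auto split: if_splits)
      next
        case 2
        then show ?thesis using qc[OF \<open>l < 3\<close> that(2)] that(3) by auto
      next
        case 3
        then show ?thesis using cc[OF \<open>l < 3\<close> that(2)] that(3) by auto
      qed
    qed
    then show ?thesis unfolding J_def by blast
  qed
  have J_eq: "J l = path_image (c j) \<union> path_image (c k)" if "{..<3} - {l} = {j, k}" for l j k
    unfolding J_def that by auto
  have others: "\<exists>j k. {..<3} - {l} = {j, k} \<and> j < 3 \<and> k < 3 \<and> j \<noteq> k" if "l < 3" for l :: nat
  proof -
    have "{..<3::nat} - {0} = {1, 2}" "{..<3::nat} - {1} = {0, 2}" "{..<3::nat} - {2} = {0, 1}"
      by auto
    moreover have "l = 0 \<or> l = 1 \<or> l = 2" using that by auto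
    ultimately show ?thesis
      by (metis one_less_numeral_iff numeral_One numeral_less_iff semiring_norm(77) zero_less_numeral
          zero_neq_one zero_neq_numeral one_eq_numeral_iff semiring_norm(83) lessI numeral_2_eq_2 numeral_3_eq_3)
  qed
  have "\<exists>D E. D \<noteq> {} \<and> open D \<and> connected D \<and> open E \<and> connected E \<and> D \<inter> E = {} \<and>
      D \<union> E = - J l \<and> frontier D = J l \<and> T' l \<subseteq> E" if l: "l < 3" for l
  proof -
    obtain j k where jk: "{..<3} - {l} = {j, k}" "j < 3" "k < 3" "j \<noteq> k" using others[OF l] by blast
    define g where "g = c j +++ reversepath (c k)"
    have g: "simple_path g" "pathfinish g = pathstart g"
      using c[OF jk(2)] c[OF jk(3)] cc[OF jk(2-4)] unfolding g_def
      by (auto intro!: simple_path_join_loop simp: arc_reversepath)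
    have "path_image g = J l"
      using c[OF jk(2)] c[OF jk(3)] unfolding g_def J_eq[OF jk(1)] by (simp add: path_image_join)
    moreover have "T' l \<noteq> {}" using a2T by (auto simp: T'_def)
    ultimately show ?thesis
      using Jordan_curve_sides[OF g conT'[OF l]] TJ[OF l] by metis
  qed
  then obtain D E where DE: "\<And>l. l < 3 \<Longrightarrow> D l \<noteq> {} \<and> open (D l) \<and> connected (D l) \<and> open (E l) \<and>
      connected (E l) \<and> D l \<inter> E l = {} \<and> D l \<union> E l = - J l \<and> frontier (D l) = J l \<and> T' l \<subseteq> E l"
    by metis
  have opn: "open (D l)" "open (E l)" and con: "connected (D l)" "connected (E l)"
    and disj: "D l \<inter> E l = {}" and un: "D l \<union> E l = - J l" and fr: "frontier (D l) = J l"
    and TE: "T' l \<subseteq> E l" if "l < 3" for l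
    using DE[OF that] by simp_all
  text \<open>A point \<open>z\<close> of \<open>D 0\<close> is separated from \<open>a 2\<close> by \<open>J 0\<close>, but neither by \<open>J 1\<close> nor by \<open>J 2\<close>,
    which meet in the arc \<open>c 0\<close>; this contradicts Janiszewski's theorem, as \<open>J 0 \<subseteq> J 1 \<union> J 2\<close>.\<close>
  obtain z where z: "z \<in> D 0" using DE[of 0] by auto
  have cJ: "path_image (c k) \<subseteq> J l" if "k < 3" "k \<noteq> l" for k l
    unfolding J_def by (rule UN_upper) (use that in simp)
  have cE: "path_image (c l) - {a 0, a 1} \<subseteq> E l" "b l \<in> E l" "a 2 \<in> E l" if "l < 3" for l
    using TE[OF that] bc[OF that] a2T unfolding T'_def by blast+
  have sep: "connected_component (- J l) z (a 2)" if l: "l < 3" "l \<noteq> 0" for l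
  proof -
    \<comment> \<open>\<open>D 0\<close> misses the whole theta graph, because \<open>c 0\<close>
      lies in \<open>J 0\<close> together with \<open>E 0\<close>. Being connected,
      \<open>D 0\<close> then lies on one side of \<open>J l\<close>.\<close>
    have "D 0 \<inter> path_image (c k) = {}" if "k < 3" for k
    proof (cases "k = 0")
      case True
      have "path_image (c 1) \<subseteq> J 0" by (rule cJ) simp_all
      moreover have "{a 0, a 1} = path_image (c 1) \<inter> path_image (c 2)" by (rule cc[symmetric]) simp_all
      ultimately have "{a 0, a 1} \<subseteq> J 0" by blast
      then have "path_image (c 0) \<subseteq> J 0 \<union> E 0" using cE(1)[of 0] by auto
      moreover have "D 0 \<inter> (J 0 \<union> E 0) = {}" using disj[of 0] un[of 0] by auto
      ultimately show ?thesis using True by auto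
    next
      case False
      have "path_image (c k) \<subseteq> J 0" by (rule cJ[OF that False])
      then show ?thesis using un[of 0] by auto
    qed
    then have "D 0 \<inter> J l = {}" unfolding J_def by auto
    then have sub: "D 0 \<subseteq> D l \<union> E l" using un[OF l(1)] by blast
    \<comment> \<open>The point \<open>b l\<close> is on the frontier of \<open>D 0\<close> but in
      the open set \<open>E l\<close>, hence outside the closure of \<open>D l\<close>.\<close>
    have "\<not> D 0 \<subseteq> D l"
    proof
      assume "D 0 \<subseteq> D l"
      then have "closure (D 0) \<subseteq> closure (D l)" by (rule closure_mono)
      moreover have "J 0 \<subseteq> closure (D 0)" using fr[of 0] by (auto simp: frontier_def)
      moreover have "closure (D l) = D l \<union> J l" using fr[OF l(1)] closure_Un_frontier[of "D l"] by simp
      moreover have "b l \<in> J 0" using bc[OF l(1)] cJ[OF l] by auto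
      ultimately have "b l \<in> D l \<union> J l" by blast
      then show False using cE(2)[OF l(1)] disj[OF l(1)] un[OF l(1)] by blast
    qed
    then have "D 0 \<inter> D l = {}"
      using connectedD[OF con(1) opn(1)[OF l(1)] opn(2)[OF l(1)], of 0] disj[OF l(1)] sub by auto
    then have "z \<in> E l" using z sub by auto
    moreover have "E l \<subseteq> - J l" using un[OF l(1)] by blast
    ultimately show ?thesis
      unfolding connected_component_def using con(2)[OF l(1)] cE(3)[OF l(1)] by blast
  qed
  have "{..<3::nat} - {0} = {1, 2}" "{..<3::nat} - {1} = {0, 2}" "{..<3::nat} - {2} = {0, 1}" by auto
  then have J12: "J 0 = path_image (c 1) \<union> path_image (c 2)" "J 1 = path_image (c 0) \<union> path_image (c 2)" "J 2 = path_image (c 0) \<union> path_image (c 1)"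
    by (simp_all only: J_eq)
  have "J 1 \<inter> J 2 = path_image (c 0) \<union> path_image (c 2) \<inter> path_image (c 1)"
    unfolding J12 by blast
  also have "path_image (c 2) \<inter> path_image (c 1) = path_image (c 0) \<inter> path_image (c 1)"
    using cc[of 2 1] cc[of 0 1] by simp
  finally have "J 1 \<inter> J 2 = path_image (c 0)" by blast
  then have "connected (J 1 \<inter> J 2)" using c[of 0] by (simp add: connected_arc_image)
  moreover have cpt: "compact (J l)" for l
    unfolding J_def using c by (intro compact_UN) (auto simp: compact_arc_image)
  ultimately have "connected_component (- (J 1 \<union> J 2)) z (a 2)"
    using Janiszewski[OF cpt compact_imp_closed[OF cpt], of 1 2] sep[of 1] sep[of 2] by simp
  moreover have "- (J 1 \<union> J 2) \<subseteq> - J 0"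
    unfolding J12 by blast
  ultimately have "connected_component (- J 0) z (a 2)"
    by (meson connected_component_of_subset)
  then obtain C where C: "connected C" "C \<subseteq> D 0 \<union> E 0" "z \<in> C" "a 2 \<in> C"
    using un[of 0] unfolding connected_component_def by auto
  have "D 0 \<inter> C = {} \<or> E 0 \<inter> C = {}"
    by (rule connectedD[OF C(1)]) (use opn[of 0] disj[of 0] C(2) in auto)
  then show False using C(3,4) z cE(3)[of 0] by auto
qed

lemma K33_drawing_image:
  assumes K: "K33_drawing a b P" and sub: "\<And>i j. i < 3 \<Longrightarrow> j < 3 \<Longrightarrow> P i j \<subseteq> S"
    and h: "continuous_on S h" "inj_on h S"
  shows "K33_drawing (h \<circ> a) (h \<circ> b) (\<lambda>i j. h ` P i j)"
  unfolding K33_drawing_def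
proof (intro conjI allI impI)
  fix i j :: nat assume ij: "i < 3" "j < 3"
  have P: "compact (P i j)" "path_connected (P i j)" "a i \<in> P i j" "b j \<in> P i j"
    using K ij by (auto simp: K33_drawing_def)
  show "compact (h ` P i j)" "path_connected (h ` P i j)"
    using P continuous_on_subset[OF h(1) sub[OF ij]]
    by (auto intro: compact_continuous_image path_connected_continuous_image)
  show "(h \<circ> a) i \<in> h ` P i j" "(h \<circ> b) j \<in> h ` P i j" using P by auto
  fix i' j' :: nat assume ij': "i' < 3" "j' < 3" "(i, j) \<noteq> (i', j')"
  have "h ` P i j \<inter> h ` P i' j' = h ` (P i j \<inter> P i' j')"
    using inj_on_image_Int[OF h(2) sub[OF ij] sub[OF ij'(1,2)]] by simp
  also have "\<dots> \<subseteq> h ` {z. i = i' \<and> z = a i \<or> j = j' \<and> z = b j}"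
    using K ij ij' unfolding K33_drawing_def by (intro image_mono) blast
  finally show "h ` P i j \<inter> h ` P i' j' \<subseteq> {z. i = i' \<and> z = (h \<circ> a) i \<or> j = j' \<and> z = (h \<circ> b) j}"
    by auto
qed

text \<open>The sphere punctured at the free point w is homeomorphic to the plane.\<close>

lemma K33_not_spherical:
  fixes a :: "nat \<Rightarrow> real^3"
  assumes K: "K33_drawing a b P" and sub: "\<And>i j. i < 3 \<Longrightarrow> j < 3 \<Longrightarrow> P i j \<subseteq> sphere 0 1"
    and w: "w \<in> sphere 0 1" "\<And>i j. i < 3 \<Longrightarrow> j < 3 \<Longrightarrow> w \<notin> P i j"
  shows False
proof -
  have "(sphere (0::real^3) 1 - {w}) homeomorphic (UNIV :: complex set)"
    using w(1) by (intro homeomorphic_punctured_sphere_affine) simp_all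
  then obtain h k where hk: "homeomorphism (sphere (0::real^3) 1 - {w}) (UNIV :: complex set) h k"
    unfolding homeomorphic_def by blast
  have "K33_drawing (h \<circ> a) (h \<circ> b) (\<lambda>i j. h ` P i j)"
  proof (rule K33_drawing_image[OF K])
    show "continuous_on (sphere 0 1 - {w}) h" "inj_on h (sphere 0 1 - {w})"
      using hk by (auto simp: homeomorphism_def intro: inj_on_inverseI)
  qed (use sub w in blast)
  then show False by (rule K33_not_planar)
qed

section \<open>K_{3,3} and its subdivisions inside bipartite drawings\<close>

locale bipartite_drawing =
  fixes adj :: "'x::t2_space \<Rightarrow> 'x \<Rightarrow> bool" and D :: "'x \<Rightarrow> 'x \<Rightarrow> 'x set"
  assumes edge: "adj Z W \<Longrightarrow> compact (D Z W) \<and> path_connected (D Z W) \<and> Z \<in> D Z W \<and> W \<in> D Z W"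
    and edge_Int: "adj Z W \<Longrightarrow> adj Z' W' \<Longrightarrow> (Z, W) \<noteq> (Z', W') \<Longrightarrow> x \<in> D Z W \<Longrightarrow> x \<in> D Z' W' \<Longrightarrow>
      x = Z \<and> Z = Z' \<or> x = W \<and> W = W'"
begin

definition walk :: "('x \<times> 'x) set \<Rightarrow> 'x set" where
  "walk S = (\<Union>(Z, W)\<in>S. D Z W)"

lemma walk_simps [simp]: "walk (insert (Z, W) S) = D Z W \<union> walk S" "walk {} = {}"
  by (auto simp: walk_def)

text \<open>By \<open>edge_Int\<close>, walks without a common edge meet only in vertices they
  share. The topological condition on intersections thus becomes a finite check on pairs of
  vertices.\<close>

lemma K33_drawing_walks:
  assumes adj: "\<And>i j Z W. i < 3 \<Longrightarrow> j < 3 \<Longrightarrow> (Z, W) \<in> S i j \<Longrightarrow> adj Z W"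
    and fin: "\<And>i j. i < 3 \<Longrightarrow> j < 3 \<Longrightarrow> finite (S i j)"
    and pc: "\<And>i j. i < 3 \<Longrightarrow> j < 3 \<Longrightarrow> path_connected (walk (S i j)) \<and> a i \<in> walk (S i j) \<and> b j \<in> walk (S i j)"
    and Int: "\<And>i j i' j' Z W Z' W'. i < 3 \<Longrightarrow> j < 3 \<Longrightarrow> i' < 3 \<Longrightarrow> j' < 3 \<Longrightarrow> (i, j) \<noteq> (i', j') \<Longrightarrow>
      (Z, W) \<in> S i j \<Longrightarrow> (Z', W') \<in> S i' j' \<Longrightarrow> (Z, W) \<noteq> (Z', W') \<and>
      (Z = Z' \<longrightarrow> i = i' \<and> Z = a i \<or> j = j' \<and> Z = b j) \<and>
      (W = W' \<longrightarrow> i = i' \<and> W = a i \<or> j = j' \<and> W = b j)"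
  shows "K33_drawing a b (\<lambda>i j. walk (S i j))"
  unfolding K33_drawing_def
proof (intro conjI allI impI)
  fix i j :: nat assume ij: "i < 3" "j < 3"
  show "compact (walk (S i j))"
    unfolding walk_def using fin[OF ij] adj[OF ij] edge by (intro compact_UN) auto
  show "path_connected (walk (S i j))" "a i \<in> walk (S i j)" "b j \<in> walk (S i j)"
    using pc[OF ij] by auto
  fix i' j' :: nat assume ij': "i' < 3" "j' < 3" "(i, j) \<noteq> (i', j')"
  show "walk (S i j) \<inter> walk (S i' j') \<subseteq> {z. i = i' \<and> z = a i \<or> j = j' \<and> z = b j}"
  proof
    fix x assume "x \<in> walk (S i j) \<inter> walk (S i' j')"
    then obtain Z W Z' W' where ZW: "(Z, W) \<in> S i j" "(Z', W') \<in> S i' j'" "x \<in> D Z W" "x \<in> D Z' W'"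
      by (auto simp: walk_def)
    note I = Int[OF ij ij' ZW(1,2)]
    show "x \<in> {z. i = i' \<and> z = a i \<or> j = j' \<and> z = b j}"
      using edge_Int[OF adj[OF ij ZW(1)] adj[OF ij'(1,2) ZW(2)] _ ZW(3,4)] I by auto
  qed
qed

lemma less_3_cases: "i < 3 \<Longrightarrow> i = 0 \<or> i = 1 \<or> i = (2::nat)"
  by auto

text \<open>The second conjunct records where the edges start; this later yields a point of the
  sphere that the drawing avoids.\<close>

lemma K33_complete:
  assumes "distinct [X, Y, Z]" "distinct [B\<^sub>1, B\<^sub>2, B\<^sub>3]"
    and "\<forall>B\<in>{B\<^sub>1, B\<^sub>2, B\<^sub>3}. adj B X \<and> adj B Y \<and> adj B Z"
  shows "\<exists>a b S. K33_drawing a b (\<lambda>i j. walk (S i j)) \<and>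
    (\<forall>i<3. \<forall>j<3. S i j \<subseteq> {(B, A). adj B A \<and> B \<in> {B\<^sub>1, B\<^sub>2, B\<^sub>3}})"
proof (intro exI conjI)
  define a where "a i = [X, Y, Z] ! i" for i
  define b where "b j = [B\<^sub>1, B\<^sub>2, B\<^sub>3] ! j" for j
  have ab: "a i \<in> {X, Y, Z}" "b i \<in> {B\<^sub>1, B\<^sub>2, B\<^sub>3}" if "i < 3" for i
    using less_3_cases[OF that] by (auto simp: a_def b_def)
  have inj: "a i = a i' \<longleftrightarrow> i = i'" "b i = b i' \<longleftrightarrow> i = i'" if "i < 3" "i' < 3" for i i'
    using nth_eq_iff_index_eq[OF assms(1)] nth_eq_iff_index_eq[OF assms(2)] that
    by (simp_all add: a_def b_def)
  have adj: "adj (b j) (a i)" if "i < 3" "j < 3" for i j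
    using bspec[OF assms(3) ab(2)[OF that(2)]] ab(1)[OF that(1)] by auto
  show "K33_drawing a b (\<lambda>i j. walk {(b j, a i)})"
    using adj edge[OF adj] inj by (intro K33_drawing_walks) auto
  show "\<forall>i<3. \<forall>j<3. {(b j, a i)} \<subseteq> {(B, A). adj B A \<and> B \<in> {B\<^sub>1, B\<^sub>2, B\<^sub>3}}"
    using adj ab by auto
qed

text \<open>\<open>X'\<close> takes the place of the third branch vertex on the side of the \<open>B\<^sub>i\<close>; in the application
  \<open>X'\<close>, \<open>Z'\<close>, \<open>C\<close>, \<open>E'\<close> are the antipodes of \<open>X\<close>, \<open>Z\<close>, \<open>B\<^sub>1\<close>, \<open>E\<close>.\<close>

lemma K33_subdivision:
  assumes dist: "distinct [X, Y, Z, X', Z']" "distinct [B\<^sub>1, B\<^sub>2, C, E, E', F]"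
    and adj: "adj B\<^sub>1 X" "adj B\<^sub>1 Y" "adj B\<^sub>1 Z" "adj B\<^sub>2 X" "adj B\<^sub>2 Y" "adj B\<^sub>2 Z"
      "adj C X'" "adj C Z'" "adj E Z'" "adj E X" "adj F X'" "adj F Y" "adj E' X'" "adj E' Z"
  shows "\<exists>a b S. K33_drawing a b (\<lambda>i j. walk (S i j)) \<and>
    (\<forall>i<3. \<forall>j<3. S i j \<subseteq> {(B, A). adj B A \<and> B \<in> {B\<^sub>1, B\<^sub>2, C, E, E', F}})"
proof (intro exI conjI)
  define a where "a = (!) [X, Y, Z]"
  define b where "b = (!) [B\<^sub>1, B\<^sub>2, X']"
  \<comment> \<open>The branch vertex X' reaches X by way of C, Z', E, then Y by way of F, and Z by
    way of E'.\<close>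
  define S where "S i j = (if j < 2 then {(b j, a i)}
      else [{(C, X'), (C, Z'), (E, Z'), (E, X)}, {(F, X'), (F, Y)}, {(E', X'), (E', Z)}] ! i)" for i j
  have S: "S 0 0 = {(B\<^sub>1, X)}" "S 1 0 = {(B\<^sub>1, Y)}" "S 2 0 = {(B\<^sub>1, Z)}"
    "S 0 1 = {(B\<^sub>2, X)}" "S 1 1 = {(B\<^sub>2, Y)}" "S 2 1 = {(B\<^sub>2, Z)}"
    "S 0 2 = {(C, X'), (C, Z'), (E, Z'), (E, X)}" "S 1 2 = {(F, X'), (F, Y)}" "S 2 2 = {(E', X'), (E', Z)}"
    by (simp_all add: S_def a_def b_def)
  note S = S S[unfolded One_nat_def]
  have ab: "a 0 = X" "a 1 = Y" "a 2 = Z" "b 0 = B\<^sub>1" "b 1 = B\<^sub>2" "b 2 = X'"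
    by (simp_all add: a_def b_def)
  note ab = ab ab[unfolded One_nat_def]
  note ends = adj[THEN edge]
  have two: "path_connected (D Q U \<union> D Q V)" if "adj Q U" "adj Q V" for Q U V
    using edge[OF that(1)] edge[OF that(2)] by (intro path_connected_Un) auto
  have "path_connected ((D C X' \<union> D C Z') \<union> (D E Z' \<union> D E X))"
    using two[OF adj(7,8)] two[OF adj(9,10)] ends by (intro path_connected_Un[of "D C X' \<union> D C Z'"]) auto
  then have four: "path_connected (D C X' \<union> (D C Z' \<union> (D E Z' \<union> D E X)))"
    by (simp add: Un_assoc)
  have mem: "(U, V) \<in> S i j \<Longrightarrow> adj U V \<and> U \<in> {B\<^sub>1, B\<^sub>2, C, E, E', F}" if "i < 3" "j < 3" for i j U V
    using less_3_cases[OF that(1)] less_3_cases[OF that(2)] adj by (elim disjE) (auto simp: S)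
  show "K33_drawing a b (\<lambda>i j. walk (S i j))"
  proof (rule K33_drawing_walks)
    fix i j :: nat assume ij: "i < 3" "j < 3"
    show "finite (S i j)" using less_3_cases[OF ij(1)] less_3_cases[OF ij(2)] by (elim disjE) (auto simp: S)
    show "path_connected (walk (S i j)) \<and> a i \<in> walk (S i j) \<and> b j \<in> walk (S i j)"
      using less_3_cases[OF ij(1)] less_3_cases[OF ij(2)] ends four two[OF adj(11,12)] two[OF adj(13,14)]
      by (elim disjE) (simp_all add: S ab)
    show "adj U V" if "(U, V) \<in> S i j" for U V using mem[OF ij that] by simp
    fix i' j' U V U' V' assume ij': "i' < 3" "j' < 3" "(i, j) \<noteq> (i', j')"
      and UV: "(U, V) \<in> S i j" "(U', V') \<in> S i' j'"
    show "(U, V) \<noteq> (U', V') \<and> (U = U' \<longrightarrow> i = i' \<and> U = a i \<or> j = j' \<and> U = b j) \<and>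
      (V = V' \<longrightarrow> i = i' \<and> V = a i \<or> j = j' \<and> V = b j)"
      using less_3_cases[OF ij(1)] less_3_cases[OF ij(2)] less_3_cases[OF ij'(1)] less_3_cases[OF ij'(2)]
        ij'(3) UV dist
      by (elim disjE) (simp_all add: S ab, auto)
  qed
  show "\<forall>i<3. \<forall>j<3. S i j \<subseteq> {(B, A). adj B A \<and> B \<in> {B\<^sub>1, B\<^sub>2, C, E, E', F}}"
    using mem by auto
qed

end

section \<open>Lifting drawings from the projective plane to the sphere\<close>

text \<open>The Veronese map \<open>x \<mapsto> x x\<^sup>T\<close> realizes the projective plane inside a normed space, where the
  library's theory of covering spaces applies.\<close>

definition veronese :: "real^3 \<Rightarrow> real^3^3" where
  "veronese x = (\<chi> i j. x $ i * x $ j)"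

lemma veronese_minus [simp]: "veronese (- x) = veronese x"
  by (simp add: veronese_def)

lemma veronese_mult: "veronese x *v u = (x \<bullet> u) *\<^sub>R x"
  by (simp add: vec_eq_iff veronese_def matrix_vector_mult_def inner_vec_def sum_distrib_left mult_ac)

text \<open>Applied to x, equal matrices give x = (y . x) y, and comparing norms makes the factor 1
  or -1.\<close>

lemma veronese_eq_iff:
  assumes "norm x = 1" "norm y = 1"
  shows "veronese x = veronese y \<longleftrightarrow> y = x \<or> y = - x"
proof
  assume "veronese x = veronese y"
  then have "veronese x *v x = veronese y *v x" by simp
  then have eq: "x = (y \<bullet> x) *\<^sub>R y"
    using assms(1) by (simp add: veronese_mult norm_eq_1)
  then have "\<bar>y \<bullet> x\<bar> = 1" using assms by (metis mult.right_neutral norm_scaleR)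
  then show "y = x \<or> y = - x" using eq by (metis abs_eq_iff' abs_1 minus_minus scaleR_minus1_left scaleR_one)
qed (auto simp: veronese_def)

lemma continuous_on_veronese: "continuous_on S veronese"
  unfolding veronese_def by (intro continuous_on_vec_lambda continuous_intros)

abbreviation "sph \<equiv> sphere (0::real^3) 1"

lemma sph_nonzero: "x \<in> sph \<Longrightarrow> x \<noteq> - x"
  by (metis add.right_inverse mem_sphere_0 norm_zero scaleR_2 scaleR_eq_0_iff zero_neq_numeral zero_neq_one)

lemma continuous_on_matrix_vector_mult: "continuous_on S (\<lambda>M::real^'n^'m. M *v u)"
proof -
  have "linear (\<lambda>M::real^'n^'m. M *v u)"
    by (intro linearI) (simp_all add: matrix_vector_mult_add_rdistrib scaleR_matrix_vector_assoc)
  then show ?thesis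
    by (simp add: linear_continuous_on linear_conv_bounded_linear)
qed

text \<open>For M = x x^T the vector M u is (x . u) x, so its normalization is the one of x, -x that
  has positive inner product with u. The sign s selects the hemisphere.\<close>

lemma homeomorphism_veronese_hemisphere:
  fixes u :: "real^3"
  assumes s: "s \<in> {1, -1}"
  shows "homeomorphism {x \<in> sph. s * (x \<bullet> u) > 0} {M \<in> veronese ` sph. M *v u \<noteq> 0} veronese
     (\<lambda>M. s *\<^sub>R sgn (M *v u))"
proof (rule homeomorphismI)
  show "continuous_on {M \<in> veronese ` sph. M *v u \<noteq> 0} (\<lambda>M. s *\<^sub>R sgn (M *v u))"
    by (intro continuous_intros continuous_on_matrix_vector_mult) auto
  have sect: "s *\<^sub>R sgn (veronese x *v u) = (s * sgn (x \<bullet> u)) *\<^sub>R x" if "x \<in> sph" for x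
    using that by (simp add: veronese_mult sgn_scaleR) (simp add: sgn_div_norm)
  show "s *\<^sub>R sgn (veronese x *v u) = x" if "x \<in> {x \<in> sph. s * (x \<bullet> u) > 0}" for x
    using that s by (auto simp: sect)
  have range: "(s * sgn (x \<bullet> u)) *\<^sub>R x \<in> {x \<in> sph. s * (x \<bullet> u) > 0}
      \<and> veronese ((s * sgn (x \<bullet> u)) *\<^sub>R x) = veronese x" if "x \<in> sph" "x \<bullet> u \<noteq> 0" for x
    using that s by (cases "x \<bullet> u > 0") auto
  have ne: "x \<bullet> u \<noteq> 0" if "veronese x *v u \<noteq> 0" for x
    using that by (auto simp: veronese_mult)
  show "(\<lambda>M. s *\<^sub>R sgn (M *v u)) ` {M \<in> veronese ` sph. M *v u \<noteq> 0} \<subseteq> {x \<in> sph. s * (x \<bullet> u) > 0}"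
    using range sect ne by force
  show "veronese (s *\<^sub>R sgn (M *v u)) = M" if "M \<in> {M \<in> veronese ` sph. M *v u \<noteq> 0}" for M
    using that range sect ne by force
qed (auto simp: continuous_on_veronese veronese_mult)

lemma covering_space_veronese: "covering_space sph veronese (veronese ` sph)"
  unfolding covering_space_def
proof (intro conjI ballI)
  fix N assume "N \<in> veronese ` sph"
  then obtain u where u: "u \<in> sph" "N = veronese u" by blast
  \<comment> \<open>The evenly covered neighbourhood \<open>T\<close> consists of the lines not
    perpendicular to u; its two sheets are open hemispheres.\<close>
  define V where "V s = {x \<in> sph. s * (x \<bullet> u) > 0}" for s :: real
  define T where "T = {M \<in> veronese ` sph. M *v u \<noteq> 0}"
  have "open ((\<lambda>M::real^3^3. M *v u) -` (- {0}))"
    by (intro open_vimage continuous_on_matrix_vector_mult) auto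
  moreover have "T = veronese ` sph \<inter> ((\<lambda>M::real^3^3. M *v u) -` (- {0}))"
    by (auto simp: T_def)
  ultimately have "openin (top_of_set (veronese ` sph)) T" by (metis openin_open_Int)
  moreover have "N \<in> T" using u by (auto simp: T_def veronese_mult norm_eq_1)
  moreover have "\<Union>{V 1, V (-1)} = sph \<inter> veronese -` T"
    by (auto simp: V_def T_def veronese_mult)
  moreover have "openin (top_of_set sph) (V s)" for s
  proof -
    have "open {x. s * (x \<bullet> u) > 0}" by (intro open_Collect_less continuous_intros)
    moreover have "V s = sph \<inter> {x. s * (x \<bullet> u) > 0}" by (auto simp: V_def)
    ultimately show ?thesis by (metis openin_open_Int)
  qed
  moreover have "pairwise disjnt {V 1, V (-1)}" by (auto simp: pairwise_def disjnt_def V_def)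
  moreover have "\<exists>q. homeomorphism (V s) T veronese q" if "s \<in> {1, -1}" for s
    using homeomorphism_veronese_hemisphere[OF that, of u] unfolding V_def T_def by blast
  ultimately show "\<exists>T. N \<in> T \<and> openin (top_of_set (veronese ` sph)) T \<and>
      (\<exists>v. \<Union>v = sph \<inter> veronese -` T \<and> (\<forall>U\<in>v. openin (top_of_set sph) U) \<and>
        pairwise disjnt v \<and> (\<forall>U\<in>v. \<exists>q. homeomorphism U T veronese q))"
    by (intro exI[of _ T] conjI exI[of _ "{V 1, V (-1)}"]) auto
qed (simp_all add: continuous_on_veronese)

text \<open>The map is independent of the chosen representative since \<open>veronese\<close> is
  even. It is closed as a continuous map from a compact to a Hausdorff space.\<close>

lemma embedding_map_projective_plane:
  "embedding_map projective_plane (top_of_set (veronese ` sph)) (\<lambda>l. veronese (SOME x. x \<in> l))"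
proof (rule injective_closed_imp_embedding_map)
  have eq: "veronese (SOME y. y \<in> {x, -x}) = veronese x" for x
  proof -
    have "(SOME y. y \<in> {x, -x}) \<in> {x, -x}" by (rule someI[of _ x]) simp
    then show ?thesis by auto
  qed
  show cont: "continuous_map projective_plane (top_of_set (veronese ` sph)) (\<lambda>l. veronese (SOME x. x \<in> l))"
  proof (rule continuous_compose_quotient_map[OF quotient_map_projective_plane])
    have "(\<lambda>l. veronese (SOME x. x \<in> l)) \<circ> (\<lambda>x. {x, -x}) = veronese"
      unfolding o_def eq ..
    then show "continuous_map sphere2 (top_of_set (veronese ` sph))
        ((\<lambda>l. veronese (SOME x. x \<in> l)) \<circ> (\<lambda>x. {x, -x}))"
      by (simp add: continuous_on_veronese)
  qed
  have "compactin projective_plane ((\<lambda>x. {x, -x}) ` sph)"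
    by (rule image_compactin[OF _ quotient_imp_continuous_map[OF quotient_map_projective_plane]])
      (simp add: compactin_subtopology)
  then have "compact_space projective_plane"
    by (simp add: compact_space_def topspace_projective_plane)
  then show "closed_map projective_plane (top_of_set (veronese ` sph)) (\<lambda>l. veronese (SOME x. x \<in> l))"
    using cont by (intro continuous_imp_closed_map) (simp_all add: Hausdorff_space_subtopology)
  show "inj_on (\<lambda>l. veronese (SOME x. x \<in> l)) (topspace projective_plane)"
  proof (rule inj_onI)
    fix k l assume "k \<in> topspace projective_plane" "l \<in> topspace projective_plane"
      and e: "veronese (SOME x. x \<in> k) = veronese (SOME x. x \<in> l)"
    then obtain x y where xy: "k = {x, -x}" "l = {y, -y}" "norm x = 1" "norm y = 1"
      by (auto simp: topspace_projective_plane)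
    then have "veronese x = veronese y" using e eq by metis
    then show "k = l" using veronese_eq_iff[OF xy(3,4)] xy(1,2) by auto
  qed
qed


section \<open>Lifting the edges of an embedded graph to the sphere\<close>

lemma lift_edge:
  assumes emb: "graph_embedding \<Gamma> (top_of_set (veronese ` sph)) p \<gamma>" and e: "{u, v} \<in> snd \<Gamma>"
    and z: "z \<in> sph" "veronese z = p u"
  shows "\<exists>L w. w \<in> sph \<and> veronese w = p v \<and> z \<in> L \<and> w \<in> L \<and> L \<subseteq> sph \<and> compact L \<and> path_connected L \<and>
    inj_on veronese L \<and> veronese ` L = \<gamma> {u, v} ` {0..1}"
proof -
  define c where "c = \<gamma> {u, v}"
  have em: "embedding_map (top_of_set {0..1}) (top_of_set (veronese ` sph)) c" "{c 0, c 1} = {p u, p v}"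
    using emb e by (auto simp: graph_embedding_def c_def)
  have cont: "continuous_on {0..1} c" "c ` {0..1} \<subseteq> veronese ` sph"
    using homeomorphic_imp_continuous_map[OF em(1)[unfolded embedding_map_def]]
    by (auto simp: continuous_map_in_subtopology)
  have inj: "inj_on c {0..1}" using embedding_map_injective[OF em(1)] by simp
  have c: "arc c" "path_image c \<subseteq> veronese ` sph"
    using cont inj by (simp_all add: arc_def path_def path_image_def)
  \<comment> \<open>The edge is an unordered pair, so its arc may have to be reversed to start at
    \<open>p u\<close>.\<close>
  have "\<exists>g. arc g \<and> path_image g = path_image c \<and> pathstart g = p u \<and> pathfinish g = p v"
  proof (cases "c 0 = p u")
    case True
    then have "c 1 = p v" using em(2) by (auto simp: doubleton_eq_iff)
    then show ?thesis using c True by (auto simp: pathstart_def pathfinish_def)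
  next
    case False
    then have "c 1 = p u" "c 0 = p v" using em(2) by (auto simp: doubleton_eq_iff)
    then show ?thesis using c
      by (intro exI[of _ "reversepath c"] conjI)
        (simp_all add: arc_reversepath, simp_all add: pathstart_def pathfinish_def reversepath_def)
  qed
  then obtain g where g: "arc g" "path_image g = path_image c" "pathstart g = p u" "pathfinish g = p v"
    by blast
  obtain h where h: "path h" "path_image h \<subseteq> sph" "pathstart h = z"
      "\<And>t. t \<in> {0..1} \<Longrightarrow> veronese (h t) = g t"
    by (rule covering_space_lift_path_strong[OF covering_space_veronese z(1) arc_imp_path[OF g(1)]])
      (use g c z in auto)
  have "inj_on veronese (path_image h)"
  proof (rule inj_onI)
    fix x y assume "x \<in> path_image h" "y \<in> path_image h" and eq: "veronese x = veronese y"
    then obtain s t where st: "s \<in> {0..1}" "t \<in> {0..1}" "x = h s" "y = h t"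
      by (auto simp: path_image_def)
    then have "g s = g t" using h(4) eq by metis
    then have "s = t" using g(1) st by (auto simp: arc_def inj_on_def)
    then show "x = y" using st by simp
  qed
  moreover have "veronese ` path_image h = \<gamma> {u, v} ` {0..1}"
  proof -
    have "veronese ` path_image h = (\<lambda>t. veronese (h t)) ` {0..1}" by (auto simp: path_image_def)
    also have "\<dots> = path_image g" unfolding path_image_def by (rule image_cong) (use h in auto)
    finally show ?thesis using g(2) by (simp add: path_image_def c_def)
  qed
  moreover have "veronese (pathfinish h) = p v"
    using h(4)[of 1] g(4) by (simp add: pathfinish_def)
  moreover have "z \<in> path_image h" "pathfinish h \<in> path_image h"
    using h(3) pathstart_in_path_image pathfinish_in_path_image by blast+
  ultimately show ?thesis
    using h(1,2) compact_path_image path_connected_path_image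
    by (intro exI[of _ "path_image h"] exI[of _ "pathfinish h"]) auto
qed

lemma graph_embedding_edge_image:
  assumes emb: "graph_embedding \<Gamma> X p \<gamma>" and e: "e \<in> snd \<Gamma>"
  shows "\<gamma> e ` {0..1} = \<gamma> e ` {0<..<1} \<union> p ` e"
proof -
  have "{0..1} = {0<..<1::real} \<union> {0, 1}" by auto
  then have "\<gamma> e ` {0..1} = \<gamma> e ` {0<..<1} \<union> {\<gamma> e 0, \<gamma> e 1}"
    by (metis image_Un image_insert image_empty)
  moreover have "{\<gamma> e 0, \<gamma> e 1} = p ` e" using emb e by (simp add: graph_embedding_def)
  ultimately show ?thesis by simp
qed

lemma graph_embedding_edge_Int:
  assumes emb: "graph_embedding \<Gamma> X p \<gamma>" and e: "e \<in> snd \<Gamma>" "e' \<in> snd \<Gamma>" "e \<noteq> e'"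
    and V: "e \<subseteq> fst \<Gamma>" "e' \<subseteq> fst \<Gamma>" and y: "y \<in> \<gamma> e ` {0..1}" "y \<in> \<gamma> e' ` {0..1}"
  shows "y \<in> p ` (e \<inter> e')"
proof -
  have *: "y \<in> E \<inter> E'" if "I \<inter> I' = {}" "I \<inter> P = {}" "I' \<inter> P = {}" "E \<subseteq> P" "E' \<subseteq> P"
    "y \<in> I \<union> E" "y \<in> I' \<union> E'" for I I' P E E'
    using that by blast
  have inj: "inj_on p (fst \<Gamma>)" using emb by (simp add: graph_embedding_def)
  have "y \<in> p ` e \<inter> p ` e'"
  proof (rule *)
    show "\<gamma> e ` {0<..<1} \<inter> \<gamma> e' ` {0<..<1} = {}" "\<gamma> e ` {0<..<1} \<inter> p ` fst \<Gamma> = {}"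
      "\<gamma> e' ` {0<..<1} \<inter> p ` fst \<Gamma> = {}"
      using emb e by (simp_all add: graph_embedding_def)
    show "y \<in> \<gamma> e ` {0<..<1} \<union> p ` e" "y \<in> \<gamma> e' ` {0<..<1} \<union> p ` e'"
      using y graph_embedding_edge_image[OF emb e(1)] graph_embedding_edge_image[OF emb e(2)] by simp_all
  qed (use V in auto)
  then show ?thesis using inj_on_image_Int[OF inj V] by simp
qed

lemma graph_embedding_vertex_on_edge:
  assumes emb: "graph_embedding \<Gamma> X p \<gamma>" and e: "e \<in> snd \<Gamma>" "e \<subseteq> fst \<Gamma>" "v \<in> fst \<Gamma>"
    and v: "p v \<in> \<gamma> e ` {0..1}"
  shows "v \<in> e"
proof -
  have "\<gamma> e ` {0<..<1} \<inter> p ` fst \<Gamma> = {}" and inj: "inj_on p (fst \<Gamma>)"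
    using emb e by (simp_all add: graph_embedding_def)
  moreover have "p v \<in> p ` fst \<Gamma>" using e by simp
  ultimately have "p v \<notin> \<gamma> e ` {0<..<1}" by (metis disjoint_iff)
  then have "p v \<in> p ` e" using v unfolding graph_embedding_edge_image[OF emb e(1)] by simp
  then show ?thesis using inj_on_image_mem_iff[OF inj e(3,2)] by simp
qed

text \<open>In \<open>adj\<close> the lift of a vertex of B comes first. The last conclusion says
  that a lift of b lies only on edges starting at a lift of b; it provides the free point in the
  final argument.\<close>

lemma bipartite_drawing_lift:
  assumes emb: "graph_embedding \<Gamma> (top_of_set (veronese ` sph)) p \<gamma>"
    and V: "A \<union> B \<subseteq> fst \<Gamma>" "A \<inter> B = {}"
    and edges: "\<forall>a\<in>A. \<forall>b\<in>B. {b, a} \<in> snd \<Gamma>"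
  obtains adj D where "bipartite_drawing adj D"
    and "\<And>Z W. adj Z W \<Longrightarrow> D Z W \<subseteq> sph" and "\<And>Z W. adj Z W \<Longrightarrow> adj (- Z) (- W)"
    and "\<And>a b Z W. a \<in> A \<Longrightarrow> b \<in> B \<Longrightarrow> Z \<in> sph \<Longrightarrow> W \<in> sph \<Longrightarrow> veronese Z = p b \<Longrightarrow>
      veronese W = p a \<Longrightarrow> adj Z W \<or> adj Z (- W)"
    and "\<And>Z W x b. adj Z W \<Longrightarrow> x \<in> D Z W \<Longrightarrow> b \<in> B \<Longrightarrow> veronese x = p b \<Longrightarrow> veronese Z = p b"
proof -
  have E: "{b, a} \<in> snd \<Gamma>" if "a \<in> A" "b \<in> B" for a b
    using edges that by blast
  have inj: "inj_on p (fst \<Gamma>)" and pV: "p ` fst \<Gamma> \<subseteq> veronese ` sph"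
    using emb by (auto simp: graph_embedding_def)
  have eqA: "a = a'" if "p a = p a'" "a \<in> A" "a' \<in> A" for a a'
    using inj that V by (auto dest: inj_onD)
  have eqB: "b = b'" if "p b = p b'" "b \<in> B" "b' \<in> B" for b b'
    using inj that V by (auto dest: inj_onD)
  have "\<exists>z. z \<in> sph \<and> veronese z = p b" if "b \<in> B" for b
  proof -
    have "p b \<in> veronese ` sph" using pV V that by blast
    then show ?thesis by (metis imageE)
  qed
  then obtain z where z: "\<And>b. b \<in> B \<Longrightarrow> z b \<in> sph \<and> veronese (z b) = p b"
    by metis
  have "\<exists>L w. w \<in> sph \<and> veronese w = p a \<and> z b \<in> L \<and> w \<in> L \<and> L \<subseteq> sph \<and> compact L \<and>
      path_connected L \<and> inj_on veronese L \<and> veronese ` L = \<gamma> {b, a} ` {0..1}" if "a \<in> A" "b \<in> B" for a b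
    using lift_edge[OF emb E[OF that]] z[OF that(2)] by blast
  then obtain L w where Lw: "\<And>a b. a \<in> A \<Longrightarrow> b \<in> B \<Longrightarrow> w a b \<in> sph \<and> veronese (w a b) = p a \<and>
      z b \<in> L a b \<and> w a b \<in> L a b \<and> L a b \<subseteq> sph \<and> compact (L a b) \<and> path_connected (L a b) \<and>
      inj_on veronese (L a b) \<and> veronese ` L a b = \<gamma> {b, a} ` {0..1}"
    by metis
  text \<open>The sheets \<open>s = 1\<close> and \<open>s = -1\<close> are the two lifts of an edge; they are antipodal.\<close>
  define sheet where "sheet a b s Z W \<longleftrightarrow> a \<in> A \<and> b \<in> B \<and> s \<in> {1, -1} \<and> Z = s *\<^sub>R z b \<and> W = s *\<^sub>R w a b"
    for a b s Z W
  define adj where "adj Z W \<longleftrightarrow> (\<exists>a b s. sheet a b s Z W)" for Z W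
  define D where "D Z W = {s *\<^sub>R x | x a b s. sheet a b s Z W \<and> x \<in> L a b}" for Z W
  have ver: "veronese (s *\<^sub>R x) = veronese x" if "s \<in> {1, -1}" for s x
    using that by auto
  have ends: "veronese Z = p b" "veronese W = p a" "Z \<in> sph" "W \<in> sph" if "sheet a b s Z W" for a b s Z W
    using that z[of b] Lw[of a b] unfolding sheet_def by (auto simp: ver)
  \<comment> \<open>Injectivity of \<open>p\<close> recovers a and b, and then s is determined
    because \<open>z b\<close> is not zero.\<close>
  have uniq: "a = a' \<and> b = b' \<and> s = s'" if "sheet a b s Z W" "sheet a' b' s' Z W" for a b s a' b' s' Z W
  proof -
    have "a = a'" "b = b'"
      using ends[OF that(1)] ends[OF that(2)] that eqA[of a a'] eqB[of b b'] by (auto simp: sheet_def)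
    moreover have "z b \<noteq> 0" using z[of b] that by (auto simp: sheet_def)
    ultimately show ?thesis using that by (auto simp: sheet_def)
  qed
  have Deq: "D Z W = (\<lambda>x. s *\<^sub>R x) ` L a b" if "sheet a b s Z W" for a b s Z W
    using that uniq[OF that] unfolding D_def by blast
  have Dinj: "inj_on veronese (D Z W)" and Dver: "veronese ` D Z W = \<gamma> {b, a} ` {0..1}"
    and Dsub: "D Z W \<subseteq> sph" if "sheet a b s Z W" for a b s Z W
  proof -
    have s: "s \<in> {1, -1}" "a \<in> A" "b \<in> B" using that by (auto simp: sheet_def)
    show "veronese ` D Z W = \<gamma> {b, a} ` {0..1}"
      using Lw[OF s(2,3)] ver[OF s(1)] unfolding Deq[OF that] by (simp add: image_image)
    show "D Z W \<subseteq> sph" using Lw[OF s(2,3)] s(1) unfolding Deq[OF that] by auto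
    have "inj_on veronese (L a b)" using Lw[OF s(2,3)] by simp
    then show "inj_on veronese (D Z W)"
      unfolding Deq[OF that] inj_on_def by (auto simp: ver[OF s(1)])
  qed
  have Dends: "Z \<in> D Z W \<and> W \<in> D Z W" if "sheet a b s Z W" for a b s Z W
    using that Lw[of a b] unfolding Deq[OF that] by (auto simp: sheet_def)
  have "bipartite_drawing adj D"
  proof
    fix Z W assume "adj Z W"
    then obtain a b s where sh: "sheet a b s Z W" unfolding adj_def by blast
    then have ab: "a \<in> A" "b \<in> B" by (auto simp: sheet_def)
    show "compact (D Z W) \<and> path_connected (D Z W) \<and> Z \<in> D Z W \<and> W \<in> D Z W"
      using Lw[OF ab] Dends[OF sh] unfolding Deq[OF sh]
      by (auto intro!: compact_continuous_image path_connected_continuous_image continuous_intros)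
    fix Z' W' x assume "adj Z' W'" and ne: "(Z, W) \<noteq> (Z', W')" and x: "x \<in> D Z W" "x \<in> D Z' W'"
    then obtain a' b' s' where sh': "sheet a' b' s' Z' W'" unfolding adj_def by blast
    then have ab': "a' \<in> A" "b' \<in> B" by (auto simp: sheet_def)
    show "x = Z \<and> Z = Z' \<or> x = W \<and> W = W'"
    proof (cases "{b, a} = {b', a'}")
      case True
      then have eq: "a = a'" "b = b'" using ab ab' V by (auto simp: doubleton_eq_iff)
      \<comment> \<open>These are the two lifts of one edge. A common point would give antipodal
        points of \<open>L a b\<close>, on which \<open>veronese\<close> is injective.\<close>
      then have "s' = - s" using sh sh' ne by (auto simp: sheet_def)
      moreover obtain l l' where l: "l \<in> L a b" "l' \<in> L a b" "x = s *\<^sub>R l" "x = s' *\<^sub>R l'"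
        using x eq unfolding Deq[OF sh] Deq[OF sh'] by auto
      moreover have "s \<in> {1, -1}" using sh by (simp add: sheet_def)
      ultimately have l': "l = - l'" by auto
      then have "l = l'"
        using Lw[OF ab] inj_onD[of veronese "L a b" l l'] l by auto
      then show ?thesis using l' sph_nonzero[of l] l(1) Lw[OF ab] by auto
    next
      case False
      \<comment> \<open>Distinct edges below meet only in a common end; injectivity of
        \<open>veronese\<close> on each lifted edge identifies x with the lift of that end.\<close>
      have "veronese x \<in> p ` ({b, a} \<inter> {b', a'})"
      proof (rule graph_embedding_edge_Int[OF emb E[OF ab] E[OF ab'] False])
        show "veronese x \<in> \<gamma> {b, a} ` {0..1}" "veronese x \<in> \<gamma> {b', a'} ` {0..1}"
          using x Dver[OF sh] Dver[OF sh'] by blast+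
      qed (use V ab ab' in auto)
      then consider "b = b'" "veronese x = p b" | "a = a'" "veronese x = p a"
        using ab ab' V by auto
      then show ?thesis
      proof cases
        case 1
        then have "veronese x = veronese Z" "veronese x = veronese Z'" using ends[OF sh] ends[OF sh'] by auto
        then have "x = Z" "x = Z'"
          using inj_onD[OF Dinj[OF sh]] inj_onD[OF Dinj[OF sh']] x Dends[OF sh] Dends[OF sh'] by blast+
        then show ?thesis by simp
      next
        case 2
        then have "veronese x = veronese W" "veronese x = veronese W'" using ends[OF sh] ends[OF sh'] by auto
        then have "x = W" "x = W'"
          using inj_onD[OF Dinj[OF sh]] inj_onD[OF Dinj[OF sh']] x Dends[OF sh] Dends[OF sh'] by blast+
        then show ?thesis by simp
      qed
    qed
  qed
  moreover have "D Z W \<subseteq> sph" "adj (- Z) (- W)" if "adj Z W" for Z W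
  proof -
    obtain a b s where sh: "sheet a b s Z W" using \<open>adj Z W\<close> unfolding adj_def by blast
    then have "sheet a b (- s) (- Z) (- W)" by (auto simp: sheet_def)
    then show "D Z W \<subseteq> sph" "adj (- Z) (- W)" using Dsub[OF sh] unfolding adj_def by blast+
  qed
  moreover have "adj Z W \<or> adj Z (- W)"
    if "a \<in> A" "b \<in> B" "Z \<in> sph" "W \<in> sph" "veronese Z = p b" "veronese W = p a" for a b Z W
  proof -
    have "Z = z b \<or> Z = - z b" "w a b = W \<or> w a b = - W"
      using veronese_eq_iff[of "z b" Z] veronese_eq_iff[of W "w a b"] z[OF that(2)] Lw[OF that(1,2)] that by auto
    then have "sheet a b 1 Z W \<or> sheet a b 1 Z (- W) \<or> sheet a b (-1) Z W \<or> sheet a b (-1) Z (- W)"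
      using that(1,2) by (auto simp: sheet_def)
    then show ?thesis unfolding adj_def by blast
  qed
  moreover have "veronese Z = p b" if "adj Z W" "x \<in> D Z W" "b \<in> B" "veronese x = p b" for Z W x b
  proof -
    obtain a' b' s where sh: "sheet a' b' s Z W" using \<open>adj Z W\<close> unfolding adj_def by blast
    then have ab': "a' \<in> A" "b' \<in> B" by (auto simp: sheet_def)
    have "p b \<in> \<gamma> {b', a'} ` {0..1}" using Dver[OF sh] that by force
    then have "b \<in> {b', a'}"
      using graph_embedding_vertex_on_edge[OF emb E[OF ab']] V ab' that by auto
    then show ?thesis using ends[OF sh] V ab' that by auto
  qed
  ultimately show thesis by (rule that)
qed

text \<open>Up to the antipodal map there are four ways in which a lift of a vertex of \<open>B\<close> can be joined to
  the lifts of the three vertices of \<open>A\<close>. Two vertices of \<open>B\<close> share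
  their way. A third vertex joined in this same way, or three others agreeing in a different way,
  gives a \<open>K\<^bsub>3,3\<^esub>\<close>; two others that differ from the shared way and from each other give a subdivision
  of \<open>K\<^bsub>3,3\<^esub>\<close>.\<close>

lemma K36_not_in_projective_plane:
  assumes emb: "embeds_in \<Gamma> projective_plane"
    and V: "A \<union> B \<subseteq> fst \<Gamma>" "A \<inter> B = {}" and card: "card A = 3" "card B = 6"
    and edges: "\<forall>a\<in>A. \<forall>b\<in>B. {b, a} \<in> snd \<Gamma>"
  shows False
proof -
  obtain p \<gamma> where p: "graph_embedding \<Gamma> (top_of_set (veronese ` sph)) p \<gamma>"
    using embeds_in_compose_embedding[OF emb embedding_map_projective_plane] unfolding embeds_in_def by blast
  have inj: "inj_on p (fst \<Gamma>)" and pV: "p ` fst \<Gamma> \<subseteq> veronese ` sph"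
    using p by (auto simp: graph_embedding_def)
  obtain adj D where drawing: "bipartite_drawing adj D"
    and Dsub: "\<And>Z W. adj Z W \<Longrightarrow> D Z W \<subseteq> sph" and anti: "\<And>Z W. adj Z W \<Longrightarrow> adj (- Z) (- W)"
    and total: "\<And>a b Z W. a \<in> A \<Longrightarrow> b \<in> B \<Longrightarrow> Z \<in> sph \<Longrightarrow> W \<in> sph \<Longrightarrow> veronese Z = p b \<Longrightarrow>
      veronese W = p a \<Longrightarrow> adj Z W \<or> adj Z (- W)"
    and avoid: "\<And>Z W x b. adj Z W \<Longrightarrow> x \<in> D Z W \<Longrightarrow> b \<in> B \<Longrightarrow> veronese x = p b \<Longrightarrow> veronese Z = p b"
  proof (rule bipartite_drawing_lift[OF p V edges], goal_cases)
    case (1 adj D)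
    show ?case using 1(2-) by (rule 1(1))
  qed
  interpret bipartite_drawing adj D by (rule drawing)
  have lift: "\<exists>z\<in>sph. veronese z = p v" if "v \<in> fst \<Gamma>" for v
  proof -
    have "p v \<in> veronese ` sph" using pV that by blast
    then show ?thesis by (metis imageE)
  qed
  have pB: "p b = p b' \<longleftrightarrow> b = b'" if "b \<in> B" "b' \<in> B" for b b'
    using inj_on_eq_iff[OF inj, of b b'] V that by auto
  \<comment> \<open>If all edges start at lifts of fewer than six vertices of \<open>B\<close>, a
    lift of a remaining vertex is off the drawing.\<close>
  have no_drawing: False
    if K: "K33_drawing a b (\<lambda>i j. walk (S i j))" and Q: "\<forall>i<3. \<forall>j<3. S i j \<subseteq> {(Z, W). adj Z W \<and> Z \<in> Q}"
      and QB: "veronese ` Q \<subseteq> p ` B'" and B': "B' \<subseteq> B" "card B' < 6" for a b S Q B'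
  proof -
    have "B' \<noteq> B" using B' card by auto
    then obtain b\<^sub>0 where b0: "b\<^sub>0 \<in> B" "b\<^sub>0 \<notin> B'" using B' by blast
    then have "b\<^sub>0 \<in> fst \<Gamma>" using V by blast
    then obtain w where w: "w \<in> sph" "veronese w = p b\<^sub>0" using lift by blast
    show False
    proof (rule K33_not_spherical[OF K _ w(1)])
      fix i j :: nat assume ij: "i < 3" "j < 3"
      show "walk (S i j) \<subseteq> sph" using Q ij Dsub unfolding walk_def by blast
      show "w \<notin> walk (S i j)"
      proof
        assume "w \<in> walk (S i j)"
        then obtain Z W where ZW: "adj Z W" "Z \<in> Q" "w \<in> D Z W" using Q ij unfolding walk_def by blast
        then have "veronese Z = p b\<^sub>0" using avoid b0 w by blast
        moreover obtain b' where "b' \<in> B'" "veronese Z = p b'" using ZW(2) QB by blast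
        ultimately show False using pB[of b\<^sub>0 b'] b0 B' by auto
      qed
    qed
  qed
  \<comment> \<open>The lift Q of b is left open, so the property is invariant under negating X, Y
    and Z together.\<close>
  define joined where "joined b X Y Z \<longleftrightarrow> (\<exists>Q. veronese Q = p b \<and> adj Q X \<and> adj Q Y \<and> adj Q Z)" for b X Y Z
  have joined_minus: "joined b (- X) (- Y) (- Z)" if "joined b X Y Z" for b X Y Z
    using that anti unfolding joined_def by (metis veronese_minus)
  have joined_swap: "joined b Y X Z" "joined b X Z Y" if "joined b X Y Z" for b X Y Z
    using that unfolding joined_def by blast+
  define general where "general X Y Z \<longleftrightarrow> distinct [X, Y, Z, - X, - Y, - Z]" for X Y Z :: "real^3"
  have ver_ne: "Q \<noteq> Q'" if "veronese Q = p b" "veronese Q' = p b'" "b \<in> B" "b' \<in> B" "b \<noteq> b'" for Q Q' b b'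
    using that pB by auto
  have three: False
    if b: "distinct [b\<^sub>1, b\<^sub>2, b\<^sub>3]" "{b\<^sub>1, b\<^sub>2, b\<^sub>3} \<subseteq> B" and gen: "general X Y Z"
      and join: "joined b\<^sub>1 X Y Z" "joined b\<^sub>2 X Y Z" "joined b\<^sub>3 X Y Z" for b\<^sub>1 b\<^sub>2 b\<^sub>3 X Y Z
  proof -
    obtain Q1 Q2 Q3 where Q: "veronese Q1 = p b\<^sub>1" "veronese Q2 = p b\<^sub>2" "veronese Q3 = p b\<^sub>3"
      and adj: "\<forall>Q\<in>{Q1, Q2, Q3}. adj Q X \<and> adj Q Y \<and> adj Q Z"
      using join unfolding joined_def by blast
    have distQ: "distinct [Q1, Q2, Q3]"
      using ver_ne[OF Q(1) Q(2)] ver_ne[OF Q(1) Q(3)] ver_ne[OF Q(2) Q(3)] b by auto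
    have "distinct [X, Y, Z]" using gen by (simp add: general_def)
    from K33_complete[OF this distQ adj] obtain a b S where "K33_drawing a b (\<lambda>i j. walk (S i j))"
      "\<forall>i<3. \<forall>j<3. S i j \<subseteq> {(B, A). adj B A \<and> B \<in> {Q1, Q2, Q3}}"
      by (elim exE conjE)
    then show False
      by (rule no_drawing[where B' = "{b\<^sub>1, b\<^sub>2, b\<^sub>3}"]) (use Q b in auto)
  qed
  \<comment> \<open>\<open>K33_subdivision\<close> applies with Q1, Q2, -Q1, Q3, -Q3, -Q4 on one
    side and -X, -Z as additional vertices on the other.\<close>
  have four: False
    if b: "distinct [b\<^sub>1, b\<^sub>2, b\<^sub>3, b\<^sub>4]" "{b\<^sub>1, b\<^sub>2, b\<^sub>3, b\<^sub>4} \<subseteq> B" and gen: "general X Y Z"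
      and join: "joined b\<^sub>1 X Y Z" "joined b\<^sub>2 X Y Z" "joined b\<^sub>3 X Y (- Z)" "joined b\<^sub>4 X (- Y) Z" 
    for b\<^sub>1 b\<^sub>2 b\<^sub>3 b\<^sub>4 X Y Z
  proof -
    obtain Q1 Q2 Q3 Q4 where Q: "veronese Q1 = p b\<^sub>1" "veronese Q2 = p b\<^sub>2" "veronese Q3 = p b\<^sub>3" "veronese Q4 = p b\<^sub>4"
      and adj: "adj Q1 X" "adj Q1 Y" "adj Q1 Z" "adj Q2 X" "adj Q2 Y" "adj Q2 Z"
        "adj Q3 X" "adj Q3 Y" "adj Q3 (- Z)" "adj Q4 X" "adj Q4 (- Y)" "adj Q4 Z"
      using join unfolding joined_def by blast
    have m: "veronese (- Q1) = p b\<^sub>1" "veronese (- Q3) = p b\<^sub>3" "veronese (- Q4) = p b\<^sub>4"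
      using Q by simp_all
    have "Q \<noteq> - Q" if "adj Q W" for Q W
      using Dsub[OF that] edge[OF that] sph_nonzero by blast
    then have "Q1 \<noteq> - Q1" "Q3 \<noteq> - Q3" using adj by blast+
    then have distQ: "distinct [Q1, Q2, - Q1, Q3, - Q3, - Q4]"
      using ver_ne[OF Q(1) Q(2)] ver_ne[OF Q(1) Q(3)] ver_ne[OF Q(1) m(2)] ver_ne[OF Q(1) m(3)]
        ver_ne[OF Q(2) m(1)] ver_ne[OF Q(2) Q(3)] ver_ne[OF Q(2) m(2)] ver_ne[OF Q(2) m(3)]
        ver_ne[OF m(1) Q(3)] ver_ne[OF m(1) m(2)] ver_ne[OF m(1) m(3)]
        ver_ne[OF Q(3) m(3)] ver_ne[OF m(2) m(3)] b by auto
    have dist: "distinct [X, Y, Z, - X, - Z]" using gen by (auto simp: general_def)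
    have adj': "adj (- Q1) (- X)" "adj (- Q1) (- Z)" "adj (- Q4) (- X)" "adj (- Q4) Y"
      "adj (- Q3) (- X)" "adj (- Q3) Z"
      using anti[OF adj(1)] anti[OF adj(3)] anti[OF adj(10)] anti[OF adj(11)] anti[OF adj(7)] anti[OF adj(9)]
      by simp_all
    from K33_subdivision[OF dist distQ adj(1-6) adj'(1,2) adj(9,7) adj'(3-6)]
    obtain a b S where "K33_drawing a b (\<lambda>i j. walk (S i j))"
      "\<forall>i<3. \<forall>j<3. S i j \<subseteq> {(B, A). adj B A \<and> B \<in> {Q1, Q2, - Q1, Q3, - Q3, - Q4}}"
      by (elim exE conjE)
    then show False
      by (rule no_drawing[where B' = "{b\<^sub>1, b\<^sub>2, b\<^sub>3, b\<^sub>4}"]) (use Q b in auto)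
  qed
  obtain a\<^sub>1 a\<^sub>2 a\<^sub>3 where a: "A = {a\<^sub>1, a\<^sub>2, a\<^sub>3}" "a\<^sub>1 \<noteq> a\<^sub>2" "a\<^sub>2 \<noteq> a\<^sub>3" "a\<^sub>1 \<noteq> a\<^sub>3"
    using card(1) unfolding card_3_iff by blast
  have aV: "a\<^sub>1 \<in> fst \<Gamma>" "a\<^sub>2 \<in> fst \<Gamma>" "a\<^sub>3 \<in> fst \<Gamma>" using V a(1) by auto
  obtain X where X: "X \<in> sph" "veronese X = p a\<^sub>1" using lift[OF aV(1)] by blast
  obtain Y where Y: "Y \<in> sph" "veronese Y = p a\<^sub>2" using lift[OF aV(2)] by blast
  obtain Z where Z: "Z \<in> sph" "veronese Z = p a\<^sub>3" using lift[OF aV(3)] by blast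
  have gen: "general X Y Z"
  proof -
    have "p a\<^sub>1 \<noteq> p a\<^sub>2" "p a\<^sub>2 \<noteq> p a\<^sub>3" "p a\<^sub>1 \<noteq> p a\<^sub>3"
      using inj_on_eq_iff[OF inj aV(1,2)] inj_on_eq_iff[OF inj aV(2,3)] inj_on_eq_iff[OF inj aV(1,3)] a
      by simp_all
    then have "veronese X \<noteq> veronese Y" "veronese Y \<noteq> veronese Z" "veronese X \<noteq> veronese Z"
      using X Y Z by simp_all
    then show ?thesis
      using sph_nonzero[OF X(1)] sph_nonzero[OF Y(1)] sph_nonzero[OF Z(1)] by (auto simp: general_def)
  qed
  have gen_minus: "general X Y (- Z)" "general X (- Y) Z" "general X (- Y) (- Z)"
    using gen by (auto simp: general_def)
  have type: "joined b X Y Z \<or> joined b X Y (- Z) \<or> joined b X (- Y) Z \<or> joined b X (- Y) (- Z)"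
    if b: "b \<in> B" for b
  proof -
    have "b \<in> fst \<Gamma>" using V b by blast
    then obtain Q where Q: "Q \<in> sph" "veronese Q = p b" using lift by blast
    have aA: "a\<^sub>1 \<in> A" "a\<^sub>2 \<in> A" "a\<^sub>3 \<in> A" using a(1) by auto
    \<comment> \<open>Choosing the lift of b that is joined to X leaves only the signs of Y and Z
      open.\<close>
    have "\<exists>Q'. Q' \<in> sph \<and> veronese Q' = p b \<and> adj Q' X"
    proof (cases "adj Q X")
      case False
      then have "adj (- Q) X" using total[OF aA(1) b Q(1) X(1) Q(2) X(2)] anti[of Q "- X"] by simp
      then show ?thesis using Q by (intro exI[of _ "- Q"]) simp
    qed (use Q in blast)
    then obtain Q' where Q': "Q' \<in> sph" "veronese Q' = p b" "adj Q' X" by blast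
    show ?thesis
      using total[OF aA(2) b Q'(1) Y(1) Q'(2) Y(2)] total[OF aA(3) b Q'(1) Z(1) Q'(2) Z(2)] Q'(2,3)
      unfolding joined_def by blast
  qed
  \<comment> \<open>Types are encoded as pairs of booleans; with four types and six vertices, two
    vertices agree.\<close>
  define sg where "sg b W = (if b then W else - W)" for b and W :: "real^3"
  have "\<exists>t. joined b X (sg (fst t) Y) (sg (snd t) Z)" if "b \<in> B" for b
    using type[OF that] unfolding sg_def by (metis fst_conv snd_conv)
  then obtain t where t: "\<And>b. b \<in> B \<Longrightarrow> joined b X (sg (fst (t b)) Y) (sg (snd (t b)) Z)"
    by metis
  have "\<not> inj_on t B"
  proof
    assume "inj_on t B"
    then have "card B \<le> card (UNIV :: (bool \<times> bool) set)" by (intro card_inj_on_le) auto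
    then show False using card(2) by simp
  qed
  then obtain b\<^sub>1 b\<^sub>2 where b12: "b\<^sub>1 \<in> B" "b\<^sub>2 \<in> B" "b\<^sub>1 \<noteq> b\<^sub>2" "t b\<^sub>1 = t b\<^sub>2"
    unfolding inj_on_def by blast
  \<comment> \<open>The signs are normalized so that the shared type is X, Y', Z'. Rewriting X, -Y',
    -Z' as -X, Y', Z' makes each other type differ from it in exactly one sign, so that
    \<open>four\<close> covers all cases up to permuting coordinates.\<close>
  define Y' Z' where "Y' = sg (fst (t b\<^sub>1)) Y" and "Z' = sg (snd (t b\<^sub>1)) Z"
  have j12: "joined b\<^sub>1 X Y' Z'" "joined b\<^sub>2 X Y' Z'"
    using t[OF b12(1)] t[OF b12(2)] b12(4) by (simp_all add: Y'_def Z'_def)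
  have gen': "general X Y' Z'" using gen gen_minus by (simp add: Y'_def Z'_def sg_def)
  then have gens: "general Y' X Z'" "general Z' X Y'" "general X Y' (- Z')" "general X (- Y') Z'"
    "general (- X) Y' Z'"
    by (auto simp: general_def)
  have "joined b X Y' Z' \<or> joined b X Y' (- Z') \<or> joined b X (- Y') Z' \<or> joined b X (- Y') (- Z')"
    if "b \<in> B" for b
    using type[OF that] by (auto simp: Y'_def Z'_def sg_def)
  then have types: "joined b X Y' Z' \<or> joined b X Y' (- Z') \<or> joined b X (- Y') Z' \<or> joined b (- X) Y' Z'"
    if "b \<in> B" for b
    using joined_minus[of b X "- Y'" "- Z'"] that by auto
  have "card (B - {b\<^sub>1, b\<^sub>2}) = 4" using b12 card(2) by (simp add: card_Diff_subset)
  then obtain C where "C \<subseteq> B - {b\<^sub>1, b\<^sub>2}" "card C = 3"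
    using obtain_subset_with_card_n[of 3 "B - {b\<^sub>1, b\<^sub>2}"] by auto
  then obtain b\<^sub>3 b\<^sub>4 b\<^sub>5 where c: "{b\<^sub>3, b\<^sub>4, b\<^sub>5} \<subseteq> B - {b\<^sub>1, b\<^sub>2}" "distinct [b\<^sub>3, b\<^sub>4, b\<^sub>5]"
    unfolding card_3_iff by auto
  have types': "joined b X Y' (- Z') \<or> joined b X (- Y') Z' \<or> joined b (- X) Y' Z'"
    if "b \<in> {b\<^sub>3, b\<^sub>4, b\<^sub>5}" for b
    using types[of b] three[of b\<^sub>1 b\<^sub>2 b X Y' Z'] b12 j12 gen' c that by auto
  have excl: "\<not> (joined b X Y' (- Z') \<and> joined b' X (- Y') Z')"
    "\<not> (joined b X Y' (- Z') \<and> joined b' (- X) Y' Z')" "\<not> (joined b X (- Y') Z' \<and> joined b' (- X) Y' Z')"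
    if "b \<in> {b\<^sub>3, b\<^sub>4, b\<^sub>5}" "b' \<in> {b\<^sub>3, b\<^sub>4, b\<^sub>5}" "b \<noteq> b'" for b b'
  proof -
    have d: "distinct [b\<^sub>1, b\<^sub>2, b, b']" "{b\<^sub>1, b\<^sub>2, b, b'} \<subseteq> B" using that c b12 by auto
    show "\<not> (joined b X Y' (- Z') \<and> joined b' X (- Y') Z')"
      using four[OF d gen' j12] by blast
    show "\<not> (joined b X Y' (- Z') \<and> joined b' (- X) Y' Z')"
      using four[OF d gens(1) joined_swap(1)[OF j12(1)] joined_swap(1)[OF j12(2)]] joined_swap(1) by blast
    show "\<not> (joined b X (- Y') Z' \<and> joined b' (- X) Y' Z')"
      using four[OF d gens(2) joined_swap(1)[OF joined_swap(2)[OF j12(1)]]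
          joined_swap(1)[OF joined_swap(2)[OF j12(2)]]] joined_swap by blast
  qed
  have c': "{b\<^sub>3, b\<^sub>4, b\<^sub>5} \<subseteq> B" using c by blast
  have ne: "b\<^sub>3 \<noteq> b\<^sub>4" "b\<^sub>4 \<noteq> b\<^sub>3" "b\<^sub>3 \<noteq> b\<^sub>5" "b\<^sub>5 \<noteq> b\<^sub>3" using c(2) by auto
  have mem: "b\<^sub>3 \<in> {b\<^sub>3, b\<^sub>4, b\<^sub>5}" "b\<^sub>4 \<in> {b\<^sub>3, b\<^sub>4, b\<^sub>5}" "b\<^sub>5 \<in> {b\<^sub>3, b\<^sub>4, b\<^sub>5}" by auto
  show False
    using types'[OF mem(1)] types'[OF mem(2)] types'[OF mem(3)]
      excl[OF mem(1,2) ne(1)] excl[OF mem(2,1) ne(2)] excl[OF mem(1,3) ne(3)] excl[OF mem(3,1) ne(4)]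
      three[OF c(2) c' gens(3)] three[OF c(2) c' gens(4)] three[OF c(2) c' gens(5)]
    by argo
qed

theorem theorem8p4:
  fixes G :: "('a, 'b) monoid_scheme"
  assumes "group G" and "finite (carrier G)" and "\<not> solvable G"
  shows "\<not> projective (nonsolvable_graph G)"
proof
  assume "projective (nonsolvable_graph G)"
  then have emb: "embeds_in (nonsolvable_graph G) projective_plane"
    and nonplanar: "\<not> embeds_in (nonsolvable_graph G) sphere2"
    by (simp_all add: projective_iff)
  interpret group G by (rule assms(1))
  have nonsol_iff: "\<not> solvable (two_gen_subgroup G x y) \<longleftrightarrow> nonsol x y" if "x \<in> carrier G" "y \<in> carrier G" for x y
    using solvable_subgroup_iff[OF generate_is_subgroup, of "{x, y}"] that by simp
  have vertexI: "x \<in> carrier G - Sol G" if "x \<in> carrier G" "y \<in> carrier G" "nonsol x y" for x y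
    using that nonsol_iff by (auto simp: Sol_def)
  show False
  proof (cases "carrier G - Sol G = {}")
    case True
    \<comment> \<open>The empty graph embeds in the sphere, so its crosscap is not 1.\<close>
    then have "nonsolvable_graph G = ({}, {})" by (auto simp: nonsolvable_graph_def)
    then have "embeds_in (nonsolvable_graph G) sphere2"
      by (simp add: embeds_in_def graph_embedding_def)
    then show False using nonplanar by simp
  next
    case False
    then obtain x y where xy: "x \<in> carrier G" "y \<in> carrier G" "nonsol x y"
      using nonsol_iff by (auto simp: Sol_def)
    obtain A B where AB: "A \<subseteq> carrier G" "B \<subseteq> carrier G" "card A = 3" "card B = 6"
      "\<forall>a\<in>A. \<forall>b\<in>B. nonsol a b"
      using nonsol_K36[OF xy] by (elim exE conjE)
    \<comment> \<open>The two classes are disjoint because elements generating a non-solvable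
      subgroup do not commute.\<close>
    have ne: "a \<noteq> b" if "a \<in> A" "b \<in> B" for a b
      using that AB nonsol_relations(1)[of a b] by (metis subset_iff)
    have "A \<noteq> {}" "B \<noteq> {}" using AB by auto
    then obtain a\<^sub>0 b\<^sub>0 where ab0: "a\<^sub>0 \<in> A" "b\<^sub>0 \<in> B" by blast
    have "A \<subseteq> carrier G - Sol G"
    proof
      fix a assume "a \<in> A"
      then show "a \<in> carrier G - Sol G" using AB ab0 by (intro vertexI[of a b\<^sub>0]) auto
    qed
    moreover have "B \<subseteq> carrier G - Sol G"
    proof
      fix b assume "b \<in> B"
      then show "b \<in> carrier G - Sol G" using AB ab0 by (intro vertexI[of b a\<^sub>0] nonsol_sym[of a\<^sub>0 b]) auto
    qed
    ultimately have V: "A \<union> B \<subseteq> fst (nonsolvable_graph G)" by (simp add: nonsolvable_graph_def)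
    have "{b, a} \<in> snd (nonsolvable_graph G)" if "a \<in> A" "b \<in> B" for a b
    proof -
      have "nonsol b a" "a \<in> carrier G" "b \<in> carrier G"
        using AB that nonsol_sym[of a b] by auto
      then show ?thesis
        using ne[OF that] nonsol_iff[of b a] V that by (auto simp: nonsolvable_graph_def)
    qed
    moreover have "A \<inter> B = {}" using ne by auto
    ultimately show False
      using K36_not_in_projective_plane[OF emb V _ AB(3,4)] by simp
  qed
qed

end
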